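(* Let $G$ and $H$ be two non-trivial groups. Let $C$ be a left-relatively convex subgroup on the free product $G*H$. If $C$ has finite Kurosh rank with respect to $G*H$, then $\mathcal{PO}_C(G*H)$ has no isolated elements.
   Context: A left-preorder on a group $\Gamma$ is a total, transitive, reflexive binary relation $\preceq$ on $\Gamma$ that is left-invariant ($g_1\preceq g_2$ implies $gg_1\preceq gg_2$) and non-trivial (not all pairs are related). For a left-preorder $\preceq$, the set $C=\{g: g\preceq 1 \text{ and } 1\preceq g\}$ is a proper subgroup of $\Gamma$, and $\preceq$ is said to be a left-preorder on $\Gamma$ relative to $C$; the positive cone is $P=\{g\in\Gamma: 1\preceq g,\ g\notin C\}$, and $\Gamma=P\sqcup P^{-1}\sqcup C$. A proper subgroup $C$ of $\Gamma$ is left-relatively convex on $\Gamma$ if there exists a left-preorder on $\Gamma$ relative to $C$. Each left-preorder is identified with the map $\phi_\preceq:\Gamma\to\{\pm1,0\}$ equal to $1$ on $P$, $-1$ on $P^{-1}$ and $0$ on $C$. $\mathcal{PO}_C(\Gamma)$ is the set of left-preorders on $\Gamma$ relative to $C$, endowed with the subspace topology from $\{\pm1,0\}^\Gamma$ (discrete topology on $\{\pm1,0\}$, product topology). Kurosh rank: by Kurosh's theorem, a subgroup $C$ of $G*H$ decomposes as $C=\mathbb{F}*\big(\ast_x\, C\cap xGx^{-1}\big)*\big(\ast_y\, C\cap yHy^{-1}\big)$, where $\mathbb{F}$ is a free subgroup, $x$ ranges over a (suitable) set of representatives of $C\backslash(G*H)/G$ and $y$ over a (suitable) set of representatives of $C\backslash(G*H)/H$.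 The Kurosh rank of $C$ with respect to $G*H$ is the free rank of $\mathbb{F}$ plus the number of non-trivial factors $C\cap xGx^{-1}$ and $C\cap yHy^{-1}$; it does not depend on the chosen decomposition. *)

theory Defs
  imports "HOL-Algebra.Coset" "HOL-Analysis.Function_Topology"
begin

section \<open>The free product of two groups\<close>

text \<open>
  Elements are the reduced words: lists of non-trivial letters from the two factors
  (\<open>Inl\<close> from \<open>G\<close>, \<open>Inr\<close> from \<open>H\<close>) in which neighbouring letters come from different factors.
\<close>

definition reduced_words ::
    "('a, 'm) monoid_scheme \<Rightarrow> ('b, 'n) monoid_scheme \<Rightarrow> ('a + 'b) list set" where
  "reduced_words G H =
     {w. set w \<subseteq> Inl ` (carrier G - {\<one>\<^bsub>G\<^esub>}) \<union> Inr ` (carrier H - {\<one>\<^bsub>H\<^esub>}) \<and>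
         distinct_adj (map isl w)}"

fun letter_mult ::
    "('a, 'm) monoid_scheme \<Rightarrow> ('b, 'n) monoid_scheme \<Rightarrow> 'a + 'b \<Rightarrow> ('a + 'b) list \<Rightarrow> ('a + 'b) list"
  where
    "letter_mult G H (Inl a) (Inl b # w) =
       (if a \<otimes>\<^bsub>G\<^esub> b = \<one>\<^bsub>G\<^esub> then w else Inl (a \<otimes>\<^bsub>G\<^esub> b) # w)"
  | "letter_mult G H (Inr a) (Inr b # w) =
       (if a \<otimes>\<^bsub>H\<^esub> b = \<one>\<^bsub>H\<^esub> then w else Inr (a \<otimes>\<^bsub>H\<^esub> b) # w)"
  | "letter_mult G H x w = x # w"

definition free_product ::
    "('a, 'm) monoid_scheme \<Rightarrow> ('b, 'n) monoid_scheme \<Rightarrow> ('a + 'b) list monoid" where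
  "free_product G H =
     \<lparr>carrier = reduced_words G H, mult = (\<lambda>u v. foldr (letter_mult G H) u v), one = []\<rparr>"

text \<open>The canonical copies of the two factors inside the free product.\<close>

definition left_factor :: "('a, 'm) monoid_scheme \<Rightarrow> ('a + 'b) list set" where
  "left_factor G = insert [] ((\<lambda>a. [Inl a]) ` (carrier G - {\<one>\<^bsub>G\<^esub>}))"

definition right_factor :: "('b, 'n) monoid_scheme \<Rightarrow> ('a + 'b) list set" where
  "right_factor H = insert [] ((\<lambda>b. [Inr b]) ` (carrier H - {\<one>\<^bsub>H\<^esub>}))"

lemma letter_mult_closed:
  assumes "group G" "group H" "[x] \<in> reduced_words G H" "w \<in> reduced_words G H"
  shows "letter_mult G H x w \<in> reduced_words G H"
proof -
  interpret G: group G by fact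
  interpret H: group H by fact
  show ?thesis
    using assms(3,4)
    by (cases "(G, H, x, w)" rule: letter_mult.cases)
       (auto simp: reduced_words_def distinct_adj_Cons hd_map split: list.splits)
qed

lemma foldr_letter_mult_closed:
  assumes "group G" "group H" "u \<in> reduced_words G H" "w \<in> reduced_words G H"
  shows "foldr (letter_mult G H) u w \<in> reduced_words G H"
  using assms(3)
proof (induction u)
  case (Cons x u)
  then have "[x] \<in> reduced_words G H" "u \<in> reduced_words G H"
    by (auto simp: reduced_words_def distinct_adj_Cons)
  then show ?case
    using Cons.IH letter_mult_closed[OF assms(1,2)] by simp
qed (use assms in simp)

lemma letter_mult_letter_mult:
  assumes "group G" "group H" "[x] \<in> reduced_words G H" "[y] \<in> reduced_words G H"
    "w \<in> reduced_words G H"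
  shows "letter_mult G H x (letter_mult G H y w) =
           foldr (letter_mult G H) (letter_mult G H x [y]) w"
proof -
  interpret G: group G by fact
  interpret H: group H by fact
  have w: "w = [] \<or> (\<exists>c v. w = Inl c # v \<and> c \<in> carrier G \<and> c \<noteq> \<one>\<^bsub>G\<^esub> \<and>
                        (v = [] \<or> (\<exists>d v'. v = Inr d # v'))) \<or>
                    (\<exists>c v. w = Inr c # v \<and> c \<in> carrier H \<and> c \<noteq> \<one>\<^bsub>H\<^esub> \<and>
                        (v = [] \<or> (\<exists>d v'. v = Inl d # v')))"
    using assms(5)
    by (cases w; cases "tl w"; cases "hd w"; cases "hd (tl w)")
       (auto simp: reduced_words_def distinct_adj_Cons)
  have G1: "a = c" if "a \<otimes>\<^bsub>G\<^esub> b = \<one>\<^bsub>G\<^esub>" "b \<otimes>\<^bsub>G\<^esub> c = \<one>\<^bsub>G\<^esub>"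
    "a \<in> carrier G" "b \<in> carrier G" "c \<in> carrier G" for a b c
    using that by (metis G.inv_equality G.inv_inv G.r_inv G.inv_closed G.inv_comm)
  have H1: "a = c" if "a \<otimes>\<^bsub>H\<^esub> b = \<one>\<^bsub>H\<^esub>" "b \<otimes>\<^bsub>H\<^esub> c = \<one>\<^bsub>H\<^esub>"
    "a \<in> carrier H" "b \<in> carrier H" "c \<in> carrier H" for a b c
    using that by (metis H.inv_equality H.inv_inv H.r_inv H.inv_closed H.inv_comm)
  have G2: "a \<otimes>\<^bsub>G\<^esub> (b \<otimes>\<^bsub>G\<^esub> c) = c" if "a \<otimes>\<^bsub>G\<^esub> b = \<one>\<^bsub>G\<^esub>"
    "a \<in> carrier G" "b \<in> carrier G" "c \<in> carrier G" for a b c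
    using that by (simp flip: G.m_assoc)
  have H2: "a \<otimes>\<^bsub>H\<^esub> (b \<otimes>\<^bsub>H\<^esub> c) = c" if "a \<otimes>\<^bsub>H\<^esub> b = \<one>\<^bsub>H\<^esub>"
    "a \<in> carrier H" "b \<in> carrier H" "c \<in> carrier H" for a b c
    using that by (simp flip: H.m_assoc)
  show ?thesis
    using assms(3,4) w
    by (cases x; cases y)
       (auto simp: reduced_words_def G.m_assoc H.m_assoc G2 H2 dest: G1 H1)
qed

lemma foldr_letter_mult_assoc:
  assumes "group G" "group H" "u \<in> reduced_words G H" "v \<in> reduced_words G H"
    "w \<in> reduced_words G H"
  shows "foldr (letter_mult G H) (foldr (letter_mult G H) u v) w =
           foldr (letter_mult G H) u (foldr (letter_mult G H) v w)"
  using assms(3)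
proof (induction u)
  case (Cons x u)
  let ?v = "foldr (letter_mult G H) u v"
  have x: "[x] \<in> reduced_words G H" and u: "u \<in> reduced_words G H"
    using Cons.prems by (auto simp: reduced_words_def distinct_adj_Cons)
  have v: "?v \<in> reduced_words G H"
    using foldr_letter_mult_closed[OF assms(1,2) u assms(4)] .
  have "foldr (letter_mult G H) (letter_mult G H x ?v) w =
          letter_mult G H x (foldr (letter_mult G H) ?v w)"
  proof (cases ?v)
    case Nil
    then show ?thesis by (cases x) auto
  next
    case (Cons y v')
    have "[y] \<in> reduced_words G H" "v' \<in> reduced_words G H"
      using v Cons by (auto simp: reduced_words_def distinct_adj_Cons)
    moreover have "letter_mult G H x (y # v') = letter_mult G H x [y] @ v'"
      by (cases x; cases y) auto
    ultimately show ?thesis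
      using letter_mult_letter_mult[OF assms(1,2) x, of y "foldr (letter_mult G H) v' w"]
        foldr_letter_mult_closed[OF assms(1,2) _ assms(5)] Cons by simp
  qed
  then show ?case
    using Cons.IH[OF u] by simp
qed simp

lemma reduced_words_left_inverse:
  assumes "group G" "group H" "w \<in> reduced_words G H"
  shows "\<exists>v\<in>reduced_words G H. foldr (letter_mult G H) v w = []"
  using assms(3)
proof (induction w)
  case Nil
  then show ?case by (intro bexI[of _ "[]"]) auto
next
  case (Cons x w)
  interpret G: group G by fact
  interpret H: group H by fact
  define y where "y = map_sum (\<lambda>a. inv\<^bsub>G\<^esub> a) (\<lambda>b. inv\<^bsub>H\<^esub> b) x"
  have "w \<in> reduced_words G H"
    using Cons.prems by (auto simp: reduced_words_def distinct_adj_Cons)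
  then obtain v where v: "v \<in> reduced_words G H" "foldr (letter_mult G H) v w = []"
    using Cons.IH by blast
  have y: "[y] \<in> reduced_words G H" and yx: "letter_mult G H y (x # w) = w"
    using Cons.prems by (cases x; auto simp: y_def reduced_words_def)+
  let ?u = "foldr (letter_mult G H) v [y]"
  have "foldr (letter_mult G H) ?u (x # w) = []"
    using foldr_letter_mult_assoc[OF assms(1,2) v(1) y Cons.prems] v yx by simp
  then show ?case
    using foldr_letter_mult_closed[OF assms(1,2) v(1) y] by blast
qed

lemma group_free_product:
  assumes "group G" "group H"
  shows "group (free_product G H)"
proof (rule groupI)
  fix w assume "w \<in> carrier (free_product G H)"
  then show "\<exists>v\<in>carrier (free_product G H). v \<otimes>\<^bsub>free_product G H\<^esub> w = \<one>\<^bsub>free_product G H\<^esub>"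
    using reduced_words_left_inverse[OF assms] by (simp add: free_product_def)
qed (use foldr_letter_mult_closed[OF assms] foldr_letter_mult_assoc[OF assms] in
      \<open>auto simp: free_product_def reduced_words_def\<close>)


section \<open>Kurosh rank\<close>

text \<open>
  A subgroup \<open>F\<close> of \<open>K\<close> is free with basis \<open>B\<close>: every element of \<open>F\<close> is the value of exactly one
  freely reduced word in \<open>B\<close>.  The letter \<open>(b, True)\<close> stands for \<open>b\<close>, and \<open>(b, False)\<close> for
  its inverse.
\<close>

definition freely_reduced :: "'g set \<Rightarrow> ('g \<times> bool) list set" where
  "freely_reduced B =
     {w. fst ` set w \<subseteq> B \<and> successively (\<lambda>(b, s) (c, t). \<not> (b = c \<and> s \<noteq> t)) w}"

definition free_basis :: "('g, 'm) monoid_scheme \<Rightarrow> 'g set \<Rightarrow> 'g set \<Rightarrow> bool" where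
  "free_basis K F B \<longleftrightarrow> subgroup F K \<and> B \<subseteq> F \<and>
     bij_betw (\<lambda>w. foldr (\<otimes>\<^bsub>K\<^esub>) (map (\<lambda>(b, s). if s then b else inv\<^bsub>K\<^esub> b) w) \<one>\<^bsub>K\<^esub>)
       (freely_reduced B) F"

text \<open>
  A subgroup \<open>C\<close> of \<open>K\<close> is the (internal) free product of the family \<open>A i\<close> (\<open>i \<in> I\<close>) of subgroups:
  every element of \<open>C\<close> is the value of exactly one reduced word over the family.  Letters carry
  their index, and trivial members of the family are allowed.
\<close>

definition family_reduced ::
    "('g, 'm) monoid_scheme \<Rightarrow> 'i set \<Rightarrow> ('i \<Rightarrow> 'g set) \<Rightarrow> ('i \<times> 'g) list set" where
  "family_reduced K I A =
     {w. set w \<subseteq> Sigma I (\<lambda>i. A i - {\<one>\<^bsub>K\<^esub>}) \<and> distinct_adj (map fst w)}"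

definition internal_free_product ::
    "('g, 'm) monoid_scheme \<Rightarrow> 'g set \<Rightarrow> 'i set \<Rightarrow> ('i \<Rightarrow> 'g set) \<Rightarrow> bool" where
  "internal_free_product K C I A \<longleftrightarrow> subgroup C K \<and> (\<forall>i\<in>I. subgroup (A i) K) \<and>
     bij_betw (\<lambda>w. foldr (\<otimes>\<^bsub>K\<^esub>) (map snd w) \<one>\<^bsub>K\<^esub>) (family_reduced K I A) C"

definition double_coset_reps ::
    "('g, 'm) monoid_scheme \<Rightarrow> 'g set \<Rightarrow> 'g set \<Rightarrow> 'g set \<Rightarrow> bool" where
  "double_coset_reps K C A X \<longleftrightarrow> X \<subseteq> carrier K \<and>
     bij_betw (\<lambda>x. C <#>\<^bsub>K\<^esub> (x <#\<^bsub>K\<^esub> A)) X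
       ((\<lambda>g. C <#>\<^bsub>K\<^esub> (g <#\<^bsub>K\<^esub> A)) ` carrier K)"

definition conj_inter :: "('g, 'm) monoid_scheme \<Rightarrow> 'g set \<Rightarrow> 'g set \<Rightarrow> 'g \<Rightarrow> 'g set" where
  "conj_inter K C A x = C \<inter> ((x <#\<^bsub>K\<^esub> A) #>\<^bsub>K\<^esub> inv\<^bsub>K\<^esub> x)"

datatype 'g kurosh_index = Free_Part | Left_Part 'g | Right_Part 'g

primrec kurosh_factor ::
    "('a, 'm) monoid_scheme \<Rightarrow> ('b, 'n) monoid_scheme \<Rightarrow> ('a + 'b) list set \<Rightarrow>
     ('a + 'b) list set \<Rightarrow> ('a + 'b) list kurosh_index \<Rightarrow> ('a + 'b) list set" where
  "kurosh_factor G H C F Free_Part = F"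
| "kurosh_factor G H C F (Left_Part x) = conj_inter (free_product G H) C (left_factor G) x"
| "kurosh_factor G H C F (Right_Part y) = conj_inter (free_product G H) C (right_factor H) y"

definition kurosh_decomposition ::
    "('a, 'm) monoid_scheme \<Rightarrow> ('b, 'n) monoid_scheme \<Rightarrow> ('a + 'b) list set \<Rightarrow>
     ('a + 'b) list set \<Rightarrow> ('a + 'b) list set \<Rightarrow> ('a + 'b) list set \<Rightarrow> bool" where
  "kurosh_decomposition G H C F X Y \<longleftrightarrow>
     double_coset_reps (free_product G H) C (left_factor G) X \<and>
     double_coset_reps (free_product G H) C (right_factor H) Y \<and>
     internal_free_product (free_product G H) C
       (insert Free_Part (Left_Part ` X \<union> Right_Part ` Y)) (kurosh_factor G H C F)"

text \<open>
  Since the rank does not depend on the decomposition, \<open>C\<close> has Kurosh rank \<open>n\<close> as soon as one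
  decomposition shows it.  The subgroup has finite Kurosh rank if it has Kurosh rank \<open>n\<close> for some
  natural number \<open>n\<close>; the finiteness conditions below exclude the default value of \<open>card\<close> on
  infinite sets.
\<close>

definition has_kurosh_rank ::
    "('a, 'm) monoid_scheme \<Rightarrow> ('b, 'n) monoid_scheme \<Rightarrow> ('a + 'b) list set \<Rightarrow> nat \<Rightarrow> bool" where
  "has_kurosh_rank G H C n \<longleftrightarrow>
     (\<exists>F B X Y. kurosh_decomposition G H C F X Y \<and> free_basis (free_product G H) F B \<and>
        (let X' = {x \<in> X. kurosh_factor G H C F (Left_Part x) \<noteq> {\<one>\<^bsub>free_product G H\<^esub>}};
             Y' = {y \<in> Y. kurosh_factor G H C F (Right_Part y) \<noteq> {\<one>\<^bsub>free_product G H\<^esub>}}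
         in finite B \<and> finite X' \<and> finite Y' \<and> n = card B + card X' + card Y'))"

definition finite_kurosh_rank ::
    "('a, 'm) monoid_scheme \<Rightarrow> ('b, 'n) monoid_scheme \<Rightarrow> ('a + 'b) list set \<Rightarrow> bool" where
  "finite_kurosh_rank G H C \<longleftrightarrow> (\<exists>n. has_kurosh_rank G H C n)"


section \<open>Left-preorders\<close>

definition left_preorder :: "('g, 'm) monoid_scheme \<Rightarrow> ('g \<times> 'g) set \<Rightarrow> bool" where
  "left_preorder K R \<longleftrightarrow> preorder_on (carrier K) R \<and> total_on (carrier K) R \<and>
     (\<forall>g\<in>carrier K. \<forall>(g1, g2)\<in>R. (g \<otimes>\<^bsub>K\<^esub> g1, g \<otimes>\<^bsub>K\<^esub> g2) \<in> R) \<and>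
     R \<noteq> carrier K \<times> carrier K"

definition preorder_kernel :: "('g, 'm) monoid_scheme \<Rightarrow> ('g \<times> 'g) set \<Rightarrow> 'g set" where
  "preorder_kernel K R = {g \<in> carrier K. (g, \<one>\<^bsub>K\<^esub>) \<in> R \<and> (\<one>\<^bsub>K\<^esub>, g) \<in> R}"

definition left_preorder_relative ::
    "('g, 'm) monoid_scheme \<Rightarrow> 'g set \<Rightarrow> ('g \<times> 'g) set \<Rightarrow> bool" where
  "left_preorder_relative K C R \<longleftrightarrow> left_preorder K R \<and> preorder_kernel K R = C"

definition positive_cone :: "('g, 'm) monoid_scheme \<Rightarrow> ('g \<times> 'g) set \<Rightarrow> 'g set" where
  "positive_cone K R = {g \<in> carrier K. (\<one>\<^bsub>K\<^esub>, g) \<in> R \<and> g \<notin> preorder_kernel K R}"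

definition left_relatively_convex :: "('g, 'm) monoid_scheme \<Rightarrow> 'g set \<Rightarrow> bool" where
  "left_relatively_convex K C \<longleftrightarrow>
     subgroup C K \<and> C \<noteq> carrier K \<and> (\<exists>R. left_preorder_relative K C R)"

text \<open>
  The sign map is made extensional (\<open>undefined\<close> off the carrier), as the library's product
  topology requires.
\<close>

definition preorder_map :: "('g, 'm) monoid_scheme \<Rightarrow> ('g \<times> 'g) set \<Rightarrow> 'g \<Rightarrow> int" where
  "preorder_map K R =
     (\<lambda>g\<in>carrier K. if g \<in> positive_cone K R then 1
                    else if g \<in> set_inv\<^bsub>K\<^esub> (positive_cone K R) then -1 else 0)"

definition PO_set :: "('g, 'm) monoid_scheme \<Rightarrow> 'g set \<Rightarrow> ('g \<Rightarrow> int) set" where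
  "PO_set K C = preorder_map K ` {R. left_preorder_relative K C R}"

definition PO_topology :: "('g, 'm) monoid_scheme \<Rightarrow> 'g set \<Rightarrow> ('g \<Rightarrow> int) topology" where
  "PO_topology K C =
     subtopology (product_topology (\<lambda>_. discrete_topology {-1, 0, 1}) (carrier K)) (PO_set K C)"

definition isolated_point :: "'p topology \<Rightarrow> 'p \<Rightarrow> bool" where
  "isolated_point T p \<longleftrightarrow> p \<in> topspace T \<and> openin T {p}"

end

theory Submission
  imports Defs
begin

text \<open>
  Let \<open>C\<close> be the kernel of the given preorder on \<open>K = G * H\<close>, which orders the cosets \<open>K/C\<close>.  A finite
  set \<open>S\<close> of reduced words, closed under suffixes, records the way in which finitely many elements of
  \<open>K\<close> act on the base coset.  Keep the order on the \<open>G\<close>-translates of \<open>S\<close> and on the \<open>H\<close>-translates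
  of \<open>S\<close>, but interleave the two arbitrarily within each cut of \<open>S\<close>.  Every such choice extends to a
  left-invariant preorder on \<open>K\<close>: an order with a \<open>G\<close>-invariant part, off which \<open>G\<close> acts freely,
  extends to all \<open>G\<close>-translates by comparing cuts, and one applies this to \<open>G\<close> and \<open>H\<close> in turn.

  Finite Kurosh rank means that \<open>S\<close> can be chosen so that the kernel of the new preorder still contains
  \<open>C\<close>; breaking ties by the old preorder makes the kernel equal to \<open>C\<close>.  It also allows \<open>S\<close> to be
  enlarged until both \<open>G\<close> and \<open>H\<close> move its maximum \<open>m\<close> upwards, to \<open>g m\<close> and \<open>h m\<close> say.  As these lie
  in the same cut of \<open>S\<close>, both \<open>g m < h m\<close> and \<open>h m < g m\<close> can be arranged, so one of the two new
  preorders differs from the old one, although both agree with it on \<open>S\<close>.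
\<close>

section \<open>Total preorders and cuts\<close>

text \<open>The relation is a predicate constrained only on \<open>S\<close>, so that a preorder of
  a large set serves unchanged on each subset; reflexivity is totality for equal arguments.\<close>

definition total_preorder :: "'g set \<Rightarrow> ('g \<Rightarrow> 'g \<Rightarrow> bool) \<Rightarrow> bool" where
  "total_preorder S leq \<longleftrightarrow>
     (\<forall>x\<in>S. \<forall>y\<in>S. leq x y \<or> leq y x) \<and>
     (\<forall>x\<in>S. \<forall>y\<in>S. \<forall>z\<in>S. leq x y \<longrightarrow> leq y z \<longrightarrow> leq x z)"

lemma total_preorder_total:
  assumes "total_preorder S leq" "x \<in> S" "y \<in> S"
  shows "leq x y \<or> leq y x"
  using assms(1)[unfolded total_preorder_def, THEN conjunct1] assms(2,3) by blast

lemma total_preorder_refl: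
  assumes "total_preorder S leq" "x \<in> S"
  shows "leq x x"
  using total_preorder_total[OF assms assms(2)] by blast

lemma total_preorder_trans:
  assumes "total_preorder S leq" "leq x y" "leq y z" "x \<in> S" "y \<in> S" "z \<in> S"
  shows "leq x z"
  using assms(1)[unfolded total_preorder_def, THEN conjunct2] assms(2-6) by blast

lemma total_preorder_subset:
  assumes "total_preorder S leq" "T \<subseteq> S"
  shows "total_preorder T leq"
  using total_preorder_total[OF assms(1)] total_preorder_trans[OF assms(1)] assms(2)
  unfolding total_preorder_def by (meson in_mono)

text \<open>
  \<open>lo u x\<close> and \<open>hi x u\<close> stand for \<open>u \<le> x\<close> and \<open>x \<le> u\<close>: two points are compared by the cuts they
  define in \<open>X\<close>, and by \<open>tie\<close> if the cuts agree.
\<close>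

definition cut_le ::
    "'x set \<Rightarrow> ('g \<Rightarrow> 'x \<Rightarrow> bool) \<Rightarrow> ('x \<Rightarrow> 'g \<Rightarrow> bool) \<Rightarrow> ('g \<Rightarrow> 'g \<Rightarrow> bool) \<Rightarrow> 'g \<Rightarrow> 'g \<Rightarrow> bool" where
  "cut_le X lo hi tie u v \<longleftrightarrow>
     (\<exists>x\<in>X. lo u x \<and> hi x v) \<or> (\<not> (\<exists>x\<in>X. lo v x \<and> hi x u) \<and> tie u v)"

text \<open>If no point of \<open>X\<close> lies between \<open>v\<close> and \<open>u\<close>,
  totality of the mixed comparisons puts every upper bound of \<open>v\<close> in \<open>X\<close>
  above \<open>u\<close>, so the cuts are nested. Transitivity then follows from the mixed law and
  from \<open>tie\<close>.\<close>

lemma total_preorder_cut_le: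
  assumes tie: "total_preorder U tie"
    and total: "\<And>u x. u \<in> U \<Longrightarrow> x \<in> X \<Longrightarrow> lo u x \<or> hi x u"
    and trans: "\<And>u v x y. u \<in> U \<Longrightarrow> v \<in> U \<Longrightarrow> x \<in> X \<Longrightarrow> y \<in> X \<Longrightarrow>
                  lo u x \<Longrightarrow> hi x v \<Longrightarrow> lo v y \<Longrightarrow> lo u y"
  shows "total_preorder U (cut_le X lo hi tie)"
  unfolding total_preorder_def
proof (intro conjI ballI impI)
  fix u v assume "u \<in> U" "v \<in> U"
  then show "cut_le X lo hi tie u v \<or> cut_le X lo hi tie v u"
    using total_preorder_total[OF tie] unfolding cut_le_def by blast
next
  fix u v w assume U: "u \<in> U" "v \<in> U" "w \<in> U"
    and uv: "cut_le X lo hi tie u v" and vw: "cut_le X lo hi tie v w"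
  have tie_trans: "tie u w" if "tie u v" "tie v w"
    using total_preorder_trans[OF tie that] U by blast
  show "cut_le X lo hi tie u w"
  proof (cases "\<exists>x\<in>X. lo u x \<and> hi x v")
    case True
    then obtain x where x: "x \<in> X" "lo u x" "hi x v" by blast
    from vw consider y where "y \<in> X" "lo v y" "hi y w" | "\<not> (\<exists>y\<in>X. lo w y \<and> hi y v)"
      unfolding cut_le_def by blast
    then show ?thesis
    proof cases
      case 1
      then show ?thesis using trans[OF U(1,2) x(1) _ x(2,3)] unfolding cut_le_def by blast
    next
      case 2
      then have "hi x w" using total[OF U(3) x(1)] x by blast
      then show ?thesis using x unfolding cut_le_def by blast
    qed
  next
    case False
    then have uv': "\<not> (\<exists>x\<in>X. lo v x \<and> hi x u)" "tie u v"
      using uv unfolding cut_le_def by blast+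
    from vw consider y where "y \<in> X" "lo v y" "hi y w" 
      | "\<not> (\<exists>y\<in>X. lo w y \<and> hi y v)" "tie v w"
      unfolding cut_le_def by blast
    then show ?thesis
    proof cases
      case 1
      then have "lo u y" using total[OF U(1)] uv' by blast
      then show ?thesis using 1 unfolding cut_le_def by blast
    next
      case 2
      then have "\<not> (\<exists>y\<in>X. lo w y \<and> hi y u)" using total[OF U(2)] uv' by blast
      then show ?thesis using 2 uv' tie_trans unfolding cut_le_def by blast
    qed
  qed
qed

text \<open>A point of \<open>X\<close> between \<open>u\<close> and \<open>v\<close> certifies
  \<open>leq u v\<close> by transitivity, and a member of \<open>X\<close> is its own certificate.
  The tie-breaker therefore has to match \<open>leq\<close> only when neither point lies in
  \<open>X\<close>.\<close>

lemma cut_le_agrees: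
  assumes leq: "total_preorder S leq" and S: "X \<subseteq> S" "u \<in> S" "v \<in> S"
    and lo: "\<And>x. x \<in> X \<Longrightarrow> lo u x \<longleftrightarrow> leq u x" "\<And>x. x \<in> X \<Longrightarrow> lo v x \<longleftrightarrow> leq v x"
    and hi: "\<And>x. x \<in> X \<Longrightarrow> hi x u \<longleftrightarrow> leq x u" "\<And>x. x \<in> X \<Longrightarrow> hi x v \<longleftrightarrow> leq x v"
    and tie: "u \<in> X \<or> v \<in> X \<or> (tie u v \<longleftrightarrow> leq u v)"
  shows "cut_le X lo hi tie u v \<longleftrightarrow> leq u v"
proof -
  have eq: "cut_le X lo hi tie u v \<longleftrightarrow>
      (\<exists>x\<in>X. leq u x \<and> leq x v) \<or> (\<not> (\<exists>x\<in>X. leq v x \<and> leq x u) \<and> tie u v)"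
    by (simp add: cut_le_def lo hi cong: bex_cong)
  have refl: "leq u u" "leq v v" and total: "leq u v \<or> leq v u"
    using total_preorder_refl[OF leq] total_preorder_total[OF leq] S by auto
  show ?thesis
  proof (cases "\<exists>x\<in>X. leq v x \<and> leq x u")
    case True
    then obtain x where x: "x \<in> X" "x \<in> S" "leq v x" "leq x u" using S(1) by blast
    have "leq u x" "leq x v" if "leq u v"
      using total_preorder_trans[OF leq that x(3)] total_preorder_trans[OF leq x(4) that] x(2) S
      by auto
    moreover have "leq u v" if "y \<in> X" "leq u y" "leq y v" for y
      using total_preorder_trans[OF leq that(2,3)] that(1) S by auto
    ultimately show ?thesis using True x(1) eq by auto
  next
    case False
    moreover have "leq u v" if "y \<in> X" "leq u y" "leq y v" for y
      using total_preorder_trans[OF leq that(2,3)] that(1) S by auto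
    ultimately show ?thesis using refl total tie eq by metis
  qed
qed

text \<open>Write a point of \<open>A <#> S\<close> as \<open>a \<otimes> s\<close>. Moving it back
  by \<open>a\<close> compares it with \<open>X\<close> inside \<open>S\<close>, since
  \<open>X\<close> is closed under \<open>A\<close>; points with the same cut are ordered by their
  \<open>S\<close>-components. Freeness makes this representation unique off \<open>X\<close>, which
  gives invariance.\<close>

lemma (in group) extend_preorder_to_translates:
  assumes A: "subgroup A G" and S: "S \<subseteq> carrier G" and XS: "X \<subseteq> S"
    and X: "\<And>a x. a \<in> A \<Longrightarrow> x \<in> X \<Longrightarrow> a \<otimes> x \<in> X"
    and free: "\<And>a s. a \<in> A \<Longrightarrow> s \<in> S - X \<Longrightarrow> a \<otimes> s \<in> S \<Longrightarrow> a = \<one>"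
    and leq: "total_preorder S leq"
    and inv: "\<And>a x y. a \<in> A \<Longrightarrow> x \<in> X \<Longrightarrow> y \<in> X \<Longrightarrow> leq x y \<Longrightarrow> leq (a \<otimes> x) (a \<otimes> y)"
  shows "\<exists>leq'. total_preorder (A <#> S) leq' \<and>
           (\<forall>u\<in>S. \<forall>v\<in>S. leq' u v \<longleftrightarrow> leq u v) \<and>
           (\<forall>a\<in>A. \<forall>u\<in>A <#> S. \<forall>v\<in>A <#> S. leq' u v \<longrightarrow> leq' (a \<otimes> u) (a \<otimes> v))"
proof -
  have Ac: "a \<in> carrier G" if "a \<in> A" for a
    using subgroup.mem_carrier[OF A that] .
  have Sc: "s \<in> carrier G" if "s \<in> S" for s using S that by blast
  have Xc: "x \<in> carrier G" if "x \<in> X" for x using XS Sc that by blast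
  note A_closed = subgroup.m_closed[OF A] subgroup.m_inv_closed[OF A] subgroup.one_closed[OF A]
  have cancel: "inv a \<otimes> (a \<otimes> x) = x" "a \<otimes> (inv a \<otimes> x) = x"
    if "a \<in> A" "x \<in> carrier G" for a x
    using that Ac by (simp_all flip: m_assoc)
  have inv_iff: "leq (a \<otimes> x) (a \<otimes> y) \<longleftrightarrow> leq x y" if "a \<in> A" "x \<in> X" "y \<in> X" for a x y
    using inv[OF that] inv[of "inv a" "a \<otimes> x" "a \<otimes> y"] that X A_closed cancel Xc by metis
  \<comment> \<open>Points of \<open>S\<close> receive the trivial representation, so that the new
    relation restricts to \<open>leq\<close> on \<open>S\<close>.\<close>
  have "\<exists>a s. u \<in> A <#> S \<longrightarrow> a \<in> A \<and> s \<in> S \<and> u = a \<otimes> s \<and> (u \<in> S \<longrightarrow> a = \<one> \<and> s = u)" for u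
  proof (cases "u \<in> S")
    case True
    then show ?thesis using A_closed(3) Sc by (intro exI[of _ \<one>] exI[of _ u]) auto
  next
    case False
    then show ?thesis by (auto simp: set_mult_def)
  qed
  then obtain \<alpha> \<sigma> where rep: "\<And>u. u \<in> A <#> S \<Longrightarrow> \<alpha> u \<in> A" "\<And>u. u \<in> A <#> S \<Longrightarrow> \<sigma> u \<in> S"
    "\<And>u. u \<in> A <#> S \<Longrightarrow> u = \<alpha> u \<otimes> \<sigma> u"
    and rep_S: "\<And>u. u \<in> A <#> S \<Longrightarrow> u \<in> S \<Longrightarrow> \<alpha> u = \<one> \<and> \<sigma> u = u"
    by metis
  have S_AS: "u \<in> A <#> S" if "u \<in> S" for u
    using that A_closed(3) Sc unfolding set_mult_def by (intro UN_I[of \<one>] UN_I[of u]) auto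
  have \<sigma>X: "\<sigma> u \<notin> X" if "u \<in> A <#> S" "u \<notin> X" for u
    using rep[OF that(1)] X that(2) by metis
  have A_AS: "c \<otimes> u \<in> A <#> S" if "c \<in> A" "u \<in> A <#> S" for c u
  proof -
    have "c \<otimes> u = (c \<otimes> \<alpha> u) \<otimes> \<sigma> u"
      using rep[OF that(2)] that Ac Sc by (metis m_assoc)
    then show ?thesis
      using rep[OF that(2)] A_closed(1) that unfolding set_mult_def by blast
  qed
  \<comment> \<open>\<open>?d\<close> carries one point of \<open>S\<close> off \<open>X\<close> to
    another point of \<open>S\<close>, so freeness forces it to be the identity. Points of
    \<open>X\<close> are excluded: as members of \<open>S\<close> they have trivial
    \<open>\<alpha>\<close>, also after translation.\<close>
  have rep_translate: "\<alpha> (c \<otimes> u) = c \<otimes> \<alpha> u" "\<sigma> (c \<otimes> u) = \<sigma> u"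
    if "c \<in> A" "u \<in> A <#> S" "u \<notin> X" for c u
  proof -
    let ?v = "c \<otimes> u" and ?d = "inv (\<alpha> (c \<otimes> u)) \<otimes> (c \<otimes> \<alpha> u)"
    note u = rep[OF that(2)] and v = rep[OF A_AS[OF that(1,2)]]
    have c: "c \<in> carrier G" "\<alpha> u \<in> carrier G" "\<sigma> u \<in> carrier G"
        "\<alpha> ?v \<in> carrier G" "\<sigma> ?v \<in> carrier G"
      using that u v Ac Sc by blast+
    have "\<alpha> ?v \<otimes> \<sigma> ?v = (c \<otimes> \<alpha> u) \<otimes> \<sigma> u"
      using u(3) v(3) c by (metis m_assoc)
    then have d: "\<sigma> ?v = ?d \<otimes> \<sigma> u"
      using c by (metis inv_solve_left' inv_closed m_assoc m_closed)
    then have "?d = \<one>"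
      using free[of ?d "\<sigma> u"] u v \<sigma>X[OF that(2,3)] A_closed that(1) by auto
    then show "\<alpha> ?v = c \<otimes> \<alpha> u" "\<sigma> ?v = \<sigma> u"
      using d c by (metis inv_equality inv_inv inv_closed m_closed r_inv inv_solve_left' r_one, simp)
  qed
  \<comment> \<open>Both \<open>u\<close> and \<open>x\<close> are divided by
    \<open>\<alpha> u\<close>, which brings them into \<open>S\<close>, where \<open>leq\<close> is
    given.\<close>
  define lo where "lo = (\<lambda>u x. leq (\<sigma> u) (inv (\<alpha> u) \<otimes> x))"
  define hi where "hi = (\<lambda>x u. leq (inv (\<alpha> u) \<otimes> x) (\<sigma> u))"
  have aX: "inv (\<alpha> u) \<otimes> x \<in> X" if "u \<in> A <#> S" "x \<in> X" for u x
    using rep[OF that(1)] X A_closed that by blast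
  have lo_X: "lo u x \<longleftrightarrow> leq u x" and hi_X: "hi x u \<longleftrightarrow> leq x u" if "u \<in> X" "x \<in> X" for u x
    using rep_S[OF S_AS] that XS Xc unfolding lo_def hi_def by auto
  have lo_c: "lo (c \<otimes> u) (c \<otimes> x) \<longleftrightarrow> lo u x" and hi_c: "hi (c \<otimes> x) (c \<otimes> u) \<longleftrightarrow> hi x u"
    if "c \<in> A" "u \<in> A <#> S" "x \<in> X" for c u x
  proof -
    have "inv (c \<otimes> \<alpha> u) \<otimes> (c \<otimes> x) = inv (\<alpha> u) \<otimes> x"
      using that rep[OF that(2)] Ac Xc cancel by (simp add: inv_mult_group m_assoc)
    then show "lo (c \<otimes> u) (c \<otimes> x) \<longleftrightarrow> lo u x" "hi (c \<otimes> x) (c \<otimes> u) \<longleftrightarrow> hi x u"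
      using lo_X hi_X inv_iff X that rep_translate[OF that(1,2)]
      by (cases "u \<in> X"; simp add: lo_def hi_def)+
  qed
  define leq' where "leq' = cut_le X lo hi (\<lambda>u v. leq (\<sigma> u) (\<sigma> v))"
  have pre: "total_preorder (A <#> S) leq'"
    unfolding leq'_def
  proof (rule total_preorder_cut_le)
    show "total_preorder (A <#> S) (\<lambda>u v. leq (\<sigma> u) (\<sigma> v))"
      using leq rep(2) unfolding total_preorder_def by blast
  next
    fix u x assume "u \<in> A <#> S" "x \<in> X"
    then show "lo u x \<or> hi x u"
      unfolding lo_def hi_def using total_preorder_total[OF leq] rep(2) aX XS by blast
  next
    fix u v x y
    assume *: "u \<in> A <#> S" "v \<in> A <#> S" "x \<in> X" "y \<in> X" "lo u x" "hi x v" "lo v y"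
    have in_S: "\<sigma> w \<in> S" "inv (\<alpha> w) \<otimes> z \<in> S" if "w \<in> A <#> S" "z \<in> X" for w z
      using rep(2)[OF that(1)] aX[OF that] XS by auto
    have "leq (inv (\<alpha> v) \<otimes> x) (inv (\<alpha> v) \<otimes> y)"
      using total_preorder_trans[OF leq *(6)[unfolded hi_def] *(7)[unfolded lo_def]] in_S * by simp
    \<comment> \<open>Invariance on \<open>X\<close> trades the translation by
      \<open>\<alpha> v\<close> for the one by \<open>\<alpha> u\<close>.\<close>
    then have "leq (inv (\<alpha> u) \<otimes> x) (inv (\<alpha> u) \<otimes> y)"
      using inv_iff[OF A_closed(2)[OF rep(1)[OF *(1)]] *(3,4)]
        inv_iff[OF A_closed(2)[OF rep(1)[OF *(2)]] *(3,4)] by simp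
    then show "lo u y"
      using total_preorder_trans[OF leq *(5)[unfolded lo_def]] in_S * unfolding lo_def by simp
  qed
  have agree: "leq' u v \<longleftrightarrow> leq u v" if "u \<in> S" "v \<in> S" for u v
    unfolding leq'_def using that rep_S[OF S_AS] Xc
    by (intro cut_le_agrees[OF leq XS]) (auto simp: lo_def hi_def)
  have "leq' (c \<otimes> u) (c \<otimes> v)" if c: "c \<in> A" and u: "u \<in> A <#> S" and v: "v \<in> A <#> S"
    and uv: "leq' u v" for c u v
  proof (cases "\<exists>x\<in>X. lo u x \<and> hi x v")
    case True
    then show ?thesis using lo_c hi_c X c u v unfolding leq'_def cut_le_def by meson
  next
    case False
    then have no: "\<not> (\<exists>x\<in>X. lo v x \<and> hi x u)" and tie: "leq (\<sigma> u) (\<sigma> v)"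
      using uv unfolding leq'_def cut_le_def by blast+
    have "lo w w" "hi w w" if "w \<in> X" for w
      using lo_X hi_X total_preorder_refl[OF leq] XS that by auto
    moreover have "lo w x \<or> hi x w" if "w \<in> A <#> S" "x \<in> X" for w x
      unfolding lo_def hi_def using total_preorder_total[OF leq] rep(2) aX XS that by blast
    \<comment> \<open>A point of \<open>X\<close> would itself lie between the two, in one direction
      or the other. So both are off \<open>X\<close>, where \<open>rep_translate\<close>
      applies.\<close>
    ultimately have "u \<notin> X" "v \<notin> X"
      using False no u v by metis+
    moreover have "\<not> (\<exists>y\<in>X. lo (c \<otimes> v) y \<and> hi y (c \<otimes> u))"
    proof
      assume "\<exists>y\<in>X. lo (c \<otimes> v) y \<and> hi y (c \<otimes> u)"
      then obtain y where y: "y \<in> X" "lo (c \<otimes> v) y" "hi y (c \<otimes> u)" by blast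
      have x: "inv c \<otimes> y \<in> X" "c \<otimes> (inv c \<otimes> y) = y"
        using X[OF A_closed(2)[OF c] y(1)] cancel(2)[OF c Xc[OF y(1)]] by auto
      then show False using no lo_c[OF c v x(1)] hi_c[OF c u x(1)] y by auto
    qed
    ultimately show ?thesis
      using tie rep_translate c u v unfolding leq'_def cut_le_def by simp
  qed
  then show ?thesis using pre agree by blast
qed

section \<open>Reduced words\<close>

locale free_product_of_groups = G: group G + H: group H
  for G :: "('a, 'm) monoid_scheme" and H :: "('b, 'n) monoid_scheme"
begin

abbreviation K :: "('a + 'b) list monoid" where
  "K \<equiv> free_product G H"

sublocale K: group K
  using group_free_product[OF G.group_axioms H.group_axioms] .

text \<open>The index is the value of \<open>isl\<close> on the letters, so that an argument
  symmetric in the two factors is given once.\<close>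

definition factor :: "bool \<Rightarrow> ('a + 'b) list set" where
  "factor b = (if b then left_factor G else right_factor H)"

definition starts :: "bool \<Rightarrow> ('a + 'b) list \<Rightarrow> bool" where
  "starts b w \<longleftrightarrow> w \<noteq> [] \<and> isl (hd w) = b"

text \<open>An element of a factor acts at the first letter of a word; suffix closure keeps what
  remains after a cancellation inside the set.\<close>

definition suffix_closed :: "('a + 'b) list set \<Rightarrow> bool" where
  "suffix_closed S \<longleftrightarrow> (\<forall>x w. x # w \<in> S \<longrightarrow> w \<in> S)"

lemma suffix_closedD: "suffix_closed S \<Longrightarrow> x # w \<in> S \<Longrightarrow> w \<in> S"
  by (auto simp: suffix_closed_def)

lemma not_starts: "\<not> starts b w \<or> \<not> starts (\<not> b) w"
  by (auto simp: starts_def)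

lemma one_K [simp]: "\<one>\<^bsub>K\<^esub> = []"
  by (simp add: free_product_def)

lemma carrier_K: "carrier K = reduced_words G H"
  by (simp add: free_product_def)

lemma single_mult: "[x] \<otimes>\<^bsub>K\<^esub> w = letter_mult G H x w"
  by (simp add: free_product_def)

lemma factor_cases:
  assumes "a \<in> factor b"
  obtains "a = []" | x where "a = [x]" "isl x = b" "[x] \<in> carrier K"
proof -
  have "a = [] \<or> (\<exists>x. a = [x] \<and> isl x = b \<and> [x] \<in> carrier K)"
    using assms
    by (cases b)
      (auto simp: factor_def left_factor_def right_factor_def carrier_K reduced_words_def image_iff)
  then show ?thesis using that by blast
qed

lemma single_in_factor: "[x] \<in> carrier K \<Longrightarrow> [x] \<in> factor (isl x)"
  by (cases x) (auto simp: factor_def left_factor_def right_factor_def carrier_K reduced_words_def)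

lemma Nil_in_factor: "[] \<in> factor b"
  by (simp add: factor_def left_factor_def right_factor_def)

lemma Cons_in_K:
  assumes "x # w \<in> carrier K"
  shows "[x] \<in> carrier K" "w \<in> carrier K" "\<not> starts (isl x) w" "[x] \<otimes>\<^bsub>K\<^esub> w = x # w"
proof -
  show "[x] \<in> carrier K" "w \<in> carrier K" and *: "\<not> starts (isl x) w"
    using assms
    by (auto simp: carrier_K reduced_words_def distinct_adj_Cons starts_def hd_map split: list.splits)
  show "[x] \<otimes>\<^bsub>K\<^esub> w = x # w"
    using * by (cases w; cases x; cases "hd w") (auto simp: single_mult starts_def)
qed

lemma factor_mult_fresh:
  assumes "a \<in> factor b" "a \<noteq> []" "w \<in> carrier K" "\<not> starts b w"
  obtains x where "isl x = b" "a \<otimes>\<^bsub>K\<^esub> w = x # w"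
proof -
  obtain x where x: "a = [x]" "isl x = b" using factor_cases[OF assms(1)] assms(2) by metis
  have "a \<otimes>\<^bsub>K\<^esub> w = x # w"
    using assms(4) x by (cases w; cases x; cases "hd w") (auto simp: single_mult starts_def)
  then show ?thesis using that x by blast
qed

lemma factor_mult_absorb:
  assumes "a \<in> factor b" "starts b w"
  obtains x t where "w = x # t" "a \<otimes>\<^bsub>K\<^esub> w = t" | x y t where "w = x # t" "isl y = b" "a \<otimes>\<^bsub>K\<^esub> w = y # t"
proof -
  obtain x t where w: "w = x # t" "isl x = b"
    using assms(2) by (cases w) (auto simp: starts_def)
  show ?thesis using assms(1)
  proof (cases rule: factor_cases)
    case 1
    then show ?thesis using that(2) w by (simp add: free_product_def)
  next
    case (2 y)
    then have "a \<otimes>\<^bsub>K\<^esub> w = t \<or> (\<exists>z. isl z = b \<and> a \<otimes>\<^bsub>K\<^esub> w = z # t)"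
      using w by (cases x; cases y) (auto simp: single_mult)
    then show ?thesis using that w by blast
  qed
qed

lemma subgroup_factor: "subgroup (factor b) K"
proof
  show "factor b \<subseteq> carrier K"
    using factor_cases K.one_closed by (metis one_K subsetI)
  show "\<one>\<^bsub>K\<^esub> \<in> factor b" by (simp add: Nil_in_factor)
  fix x assume x: "x \<in> factor b"
  show "x \<otimes>\<^bsub>K\<^esub> y \<in> factor b" if "y \<in> factor b" for y
    using x that
    by (cases b) (auto simp: factor_def left_factor_def right_factor_def free_product_def split: if_splits)
  show "inv\<^bsub>K\<^esub> x \<in> factor b"
  proof -
    define y where "y = map (map_sum (\<lambda>a. inv\<^bsub>G\<^esub> a) (\<lambda>b. inv\<^bsub>H\<^esub> b)) x"
    have "y \<in> factor b" "y \<otimes>\<^bsub>K\<^esub> x = []" 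
      using x
      by (cases b; auto simp: y_def factor_def left_factor_def right_factor_def free_product_def)+
    moreover have "y \<in> carrier K" "x \<in> carrier K"
      using calculation x factor_cases K.one_closed by (metis one_K)+
    ultimately show ?thesis by (metis K.inv_equality one_K)
  qed
qed

lemma factor_in_K: "a \<in> factor b \<Longrightarrow> a \<in> carrier K"
  using subgroup.mem_carrier[OF subgroup_factor] .

lemma K_induct [consumes 1, case_names one factor]:
  assumes "w \<in> carrier K" "P []"
    and "\<And>b a w. a \<in> factor b \<Longrightarrow> w \<in> carrier K \<Longrightarrow> P w \<Longrightarrow> P (a \<otimes>\<^bsub>K\<^esub> w)"
  shows "P w"
  using assms(1)
proof (induction w)
  case (Cons x w)
  then show ?case
    using assms(3)[of "[x]" "isl x" w] Cons_in_K[OF Cons.prems] single_in_factor by simp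
qed (rule assms(2))

section \<open>Translates of suffix-closed sets under a factor\<close>

lemma translates_iff: "w \<in> factor b <#>\<^bsub>K\<^esub> S \<longleftrightarrow> (\<exists>a\<in>factor b. \<exists>s\<in>S. w = a \<otimes>\<^bsub>K\<^esub> s)"
  by (auto simp: set_mult_def)

lemma subset_translates: "S \<subseteq> carrier K \<Longrightarrow> S \<subseteq> factor b <#>\<^bsub>K\<^esub> S"
  using Nil_in_factor K.l_one by (auto simp: translates_iff) (metis one_K subsetD)

lemma translates_in_K: "S \<subseteq> carrier K \<Longrightarrow> factor b <#>\<^bsub>K\<^esub> S \<subseteq> carrier K"
  by (auto simp: translates_iff intro!: K.m_closed dest: factor_in_K)

lemma translates_closed:
  assumes "S \<subseteq> carrier K" "a \<in> factor b" "w \<in> factor b <#>\<^bsub>K\<^esub> S"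
  shows "a \<otimes>\<^bsub>K\<^esub> w \<in> factor b <#>\<^bsub>K\<^esub> S"
proof -
  obtain c s where w: "c \<in> factor b" "s \<in> S" "w = c \<otimes>\<^bsub>K\<^esub> s"
    using assms(3) by (auto simp: translates_iff)
  then have "a \<otimes>\<^bsub>K\<^esub> w = (a \<otimes>\<^bsub>K\<^esub> c) \<otimes>\<^bsub>K\<^esub> s"
    using K.m_assoc[of a c s] assms(1,2) factor_in_K by auto
  then show ?thesis
    using w subgroup.m_closed[OF subgroup_factor assms(2)] by (auto simp: translates_iff)
qed

text \<open>A product \<open>a s\<close> that does not start in factor \<open>b\<close> arises by
  cancelling the first letter of \<open>s\<close>, which leaves a suffix, or with \<open>a\<close>
  trivial. New words thus always start in the acting factor.\<close>

lemma translates_not_starts: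
  assumes "S \<subseteq> carrier K" "suffix_closed S" "w \<in> factor b <#>\<^bsub>K\<^esub> S" "\<not> starts b w"
  shows "w \<in> S"
proof -
  obtain a s where w: "a \<in> factor b" "s \<in> S" "w = a \<otimes>\<^bsub>K\<^esub> s"
    using assms(3) by (auto simp: translates_iff)
  have s: "s \<in> carrier K" using w assms(1) by blast
  show ?thesis
  proof (cases "starts b s")
    case True
    from w(1) True show ?thesis
      by (rule factor_mult_absorb)
        (use w assms(2,4) in \<open>auto simp: starts_def dest: suffix_closedD\<close>)
  next
    case False
    then have "a = []"
      using factor_mult_fresh[OF w(1) _ s] assms(4) w(3) by (metis starts_def list.sel(1) list.discI)
    then show ?thesis using w s K.l_one by simp
  qed
qed

text \<open>Multiplication by a factor cancels, replaces or adds one first letter, so in each case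
  the tail of the product is a suffix of \<open>s\<close>.\<close>

lemma translates_tail:
  assumes "S \<subseteq> carrier K" "suffix_closed S" "x # w \<in> factor b <#>\<^bsub>K\<^esub> S"
  shows "w \<in> S"
proof -
  obtain a s where w: "a \<in> factor b" "s \<in> S" "x # w = a \<otimes>\<^bsub>K\<^esub> s"
    using assms(3) by (auto simp: translates_iff)
  have s: "s \<in> carrier K" using w assms(1) by blast
  show ?thesis
  proof (cases "starts b s")
    case True
    from w(1) True show ?thesis
      by (rule factor_mult_absorb) (use w assms(2) in \<open>auto dest: suffix_closedD\<close>)
  next
    case False
    show ?thesis
    proof (cases "a = []")
      case True
      then show ?thesis using w s K.l_one assms(2) by (auto dest: suffix_closedD)
    next
      case a: False
      show ?thesis
        by (rule factor_mult_fresh[OF w(1) a s False]) (use w in auto)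
    qed
  qed
qed

lemma suffix_closed_translates:
  assumes "S \<subseteq> carrier K" "suffix_closed S"
  shows "suffix_closed (factor b <#>\<^bsub>K\<^esub> S)"
  using translates_tail[OF assms] subset_translates[OF assms(1)] unfolding suffix_closed_def by blast

text \<open>A word cannot start in both factors. This independence of the two sides away from
  \<open>S\<close> is what makes free interleaving possible.\<close>

lemma translates_Int:
  assumes "S \<subseteq> carrier K" "suffix_closed S"
    "w \<in> factor b <#>\<^bsub>K\<^esub> S" "w \<in> factor (\<not> b) <#>\<^bsub>K\<^esub> S"
  shows "w \<in> S"
  using translates_not_starts[OF assms(1,2)] assms(3,4) not_starts by blast

end
section \<open>Extending a preorder to the free product\<close>

definition left_invariant :: "('g, 'm) monoid_scheme \<Rightarrow> ('g \<Rightarrow> 'g \<Rightarrow> bool) \<Rightarrow> bool" where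
  "left_invariant K leq \<longleftrightarrow>
     (\<forall>k\<in>carrier K. \<forall>u\<in>carrier K. \<forall>v\<in>carrier K.
        leq u v \<longrightarrow> leq (k \<otimes>\<^bsub>K\<^esub> u) (k \<otimes>\<^bsub>K\<^esub> v))"

lemma left_invariantD:
  "left_invariant K leq \<Longrightarrow> leq u v \<Longrightarrow> k \<in> carrier K \<Longrightarrow> u \<in> carrier K \<Longrightarrow> v \<in> carrier K \<Longrightarrow>
     leq (k \<otimes>\<^bsub>K\<^esub> u) (k \<otimes>\<^bsub>K\<^esub> v)"
  by (auto simp: left_invariant_def)

context free_product_of_groups
begin

lemma left_invariant_if_factor_invariant:
  assumes "\<And>b a u v. a \<in> factor b \<Longrightarrow> u \<in> carrier K \<Longrightarrow> v \<in> carrier K \<Longrightarrow> leq u v \<Longrightarrow>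
             leq (a \<otimes>\<^bsub>K\<^esub> u) (a \<otimes>\<^bsub>K\<^esub> v)"
  shows "left_invariant K leq"
proof -
  have "leq (k \<otimes>\<^bsub>K\<^esub> u) (k \<otimes>\<^bsub>K\<^esub> v)"
    if "k \<in> carrier K" "u \<in> carrier K" "v \<in> carrier K" "leq u v" for k u v
    using that
  proof (induction k rule: K_induct)
    case one
    then show ?case using K.l_one by simp
  next
    case (factor b a w)
    then show ?case
      using assms[of a b "w \<otimes>\<^bsub>K\<^esub> u" "w \<otimes>\<^bsub>K\<^esub> v"] factor_in_K by (simp add: K.m_assoc)
  qed
  then show ?thesis by (simp add: left_invariant_def)
qed

section \<open>Exhaustion of the free product by alternating translates\<close>

definition star :: "('a + 'b) list set \<Rightarrow> ('a + 'b) list set" where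
  "star S = (factor True <#>\<^bsub>K\<^esub> S) \<union> (factor False <#>\<^bsub>K\<^esub> S)"

lemma translates_subset_star: "factor b <#>\<^bsub>K\<^esub> S \<subseteq> star S"
  by (cases b) (auto simp: star_def)

text \<open>
  \<open>stage S n\<close> is closed under the factor that was applied last, and \<open>core S n\<close> is the part of it
  that is closed under the factor to be applied next; that factor acts freely off the core.
\<close>

fun stage :: "('a + 'b) list set \<Rightarrow> nat \<Rightarrow> ('a + 'b) list set" where
  "stage S 0 = star S"
| "stage S (Suc n) = factor (even n) <#>\<^bsub>K\<^esub> stage S n"

fun core :: "('a + 'b) list set \<Rightarrow> nat \<Rightarrow> ('a + 'b) list set" where
  "core S 0 = factor True <#>\<^bsub>K\<^esub> S"
| "core S (Suc 0) = factor False <#>\<^bsub>K\<^esub> S"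
| "core S (Suc (Suc n)) = stage S (Suc n)"

context
  fixes S assumes S: "S \<subseteq> carrier K" "suffix_closed S"
begin

lemma star_in_K: "star S \<subseteq> carrier K"
  using translates_in_K[OF S(1)] by (auto simp: star_def)

lemma stage_in_K: "stage S n \<subseteq> carrier K"
  by (induction n) (simp_all add: star_in_K translates_in_K)

lemma stage_Suc: "stage S n \<subseteq> stage S (Suc n)"
  using subset_translates[OF stage_in_K] by simp

lemma stage_mono: "m \<le> n \<Longrightarrow> stage S m \<subseteq> stage S n"
  by (rule lift_Suc_mono_le[of "stage S"]) (rule stage_Suc)

lemma suffix_closed_stage: "suffix_closed (stage S n)"
proof (induction n)
  case 0
  show ?case
    using suffix_closed_translates[OF S] by (auto simp: star_def suffix_closed_def)
next
  case (Suc n)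
  then show ?case using suffix_closed_translates[OF stage_in_K] by simp
qed

lemma core_subset: "core S n \<subseteq> stage S n" "core S (Suc n) \<subseteq> stage S n"
proof -
  show "core S (Suc n) \<subseteq> stage S n" by (cases n) (auto simp: star_def)
  show "core S n \<subseteq> stage S n"
  proof (cases n)
    case (Suc m)
    have "core S (Suc m) \<subseteq> stage S m" by (cases m) (auto simp: star_def)
    then show ?thesis using stage_Suc Suc by blast
  qed (simp add: star_def)
qed

lemma core_closed:
  assumes "a \<in> factor (even n)" "x \<in> core S n"
  shows "a \<otimes>\<^bsub>K\<^esub> x \<in> core S n"
  using assms translates_closed[OF S(1)] translates_closed[OF stage_in_K]
  by (cases "(S, n)" rule: core.cases) simp_all

text \<open>Words added at the last step start in the factor \<open>odd n\<close>, so any other word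
  was present before. The first two indices need separate care because the star already contains
  translates under both factors.\<close>

lemma stage_not_starts:
  assumes "s \<in> stage S n" "\<not> starts (odd n) s"
  shows "s \<in> core S n"
proof (cases "(S, n)" rule: core.cases)
  case (1 S')
  then show ?thesis
    using assms translates_not_starts[OF S, of s False] subset_translates[OF S(1), of True]
    by (auto simp: star_def)
next
  case (2 S')
  have "s \<in> star S"
    using assms 2 translates_not_starts[OF stage_in_K suffix_closed_stage, of s True 0] by simp
  then show ?thesis
    using assms 2 translates_not_starts[OF S, of s True] subset_translates[OF S(1), of False]
    by (auto simp: star_def)
next
  case (3 S' m)
  then show ?thesis
    using assms translates_not_starts[OF stage_in_K suffix_closed_stage, of s "odd m" "Suc m"]
    by simp
qed

text \<open>Off the core a word starts in the other factor, so a non-trivial \<open>a\<close>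
  becomes a new first letter. The product then lies in the core if it lies in the stage, and
  translating back by \<open>inv a\<close> would put \<open>s\<close> in the core.\<close>

lemma free_off_core:
  assumes a: "a \<in> factor (even n)" and s: "s \<in> stage S n - core S n" and as: "a \<otimes>\<^bsub>K\<^esub> s \<in> stage S n"
  shows "a = []"
proof (rule ccontr)
  assume "a \<noteq> []"
  have sK: "s \<in> carrier K" using s stage_in_K by blast
  have "starts (odd n) s" using stage_not_starts s by blast
  then have "\<not> starts (even n) s" by (auto simp: starts_def)
  then obtain x where "isl x = even n" "a \<otimes>\<^bsub>K\<^esub> s = x # s"
    using factor_mult_fresh[OF a \<open>a \<noteq> []\<close> sK] by blast
  then have "\<not> starts (odd n) (a \<otimes>\<^bsub>K\<^esub> s)" by (simp add: starts_def)
  then have "a \<otimes>\<^bsub>K\<^esub> s \<in> core S n" using stage_not_starts as by blast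
  then have "inv\<^bsub>K\<^esub> a \<otimes>\<^bsub>K\<^esub> (a \<otimes>\<^bsub>K\<^esub> s) \<in> core S n"
    using core_closed subgroup.m_inv_closed[OF subgroup_factor a] by blast
  moreover have "inv\<^bsub>K\<^esub> a \<otimes>\<^bsub>K\<^esub> (a \<otimes>\<^bsub>K\<^esub> s) = s"
    using sK factor_in_K[OF a] K.l_inv K.l_one by (simp flip: K.m_assoc)
  ultimately show False using s by simp
qed

lemma stage_exhausts:
  assumes "[] \<in> S" "w \<in> carrier K"
  shows "\<exists>n. w \<in> stage S n"
  using assms(2)
proof (induction w rule: K_induct)
  case one
  then show ?case
    using assms(1) subset_translates[OF S(1), of True] by (intro exI[of _ 0]) (auto simp: star_def)
next
  case (factor b a w)
  then obtain n where "w \<in> stage S n" by blast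
  \<comment> \<open>The factors alternate, so after at most one further stage it is the turn of the
    factor of \<open>a\<close>.\<close>
  then obtain m where "w \<in> stage S m" "even m = b"
    using stage_Suc by (cases "even n = b") (blast, metis even_Suc subsetD)
  then have "a \<otimes>\<^bsub>K\<^esub> w \<in> stage S (Suc m)" using factor by (auto simp: translates_iff)
  then show ?case by blast
qed

text \<open>One-step extensions, alternating between the factors, give compatible preorders on all
  stages, and their union is the required one. The recursion carries invariance on two consecutive
  cores, one for each factor.\<close>

theorem extend_to_free_product:
  assumes "[] \<in> S" and leq: "total_preorder (star S) leq"
    and inv: "\<And>b a u v. a \<in> factor b \<Longrightarrow> u \<in> factor b <#>\<^bsub>K\<^esub> S \<Longrightarrow> v \<in> factor b <#>\<^bsub>K\<^esub> S \<Longrightarrow>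
                leq u v \<Longrightarrow> leq (a \<otimes>\<^bsub>K\<^esub> u) (a \<otimes>\<^bsub>K\<^esub> v)"
  shows "\<exists>leq'. total_preorder (carrier K) leq' \<and> left_invariant K leq' \<and>
           (\<forall>u\<in>star S. \<forall>v\<in>star S. leq' u v \<longleftrightarrow> leq u v)"
proof -
  define inv_on where "inv_on = (\<lambda>n R. \<forall>a\<in>factor (even n). \<forall>u\<in>core S n. \<forall>v\<in>core S n.
    R u v \<longrightarrow> R (a \<otimes>\<^bsub>K\<^esub> u) (a \<otimes>\<^bsub>K\<^esub> v))"
  define P where "P = (\<lambda>n R. total_preorder (stage S n) R \<and> inv_on n R \<and> inv_on (Suc n) R \<and>
    (n = 0 \<longrightarrow> R = leq))"
  define Q where "Q = (\<lambda>n R R'. \<forall>u\<in>stage S n. \<forall>v\<in>stage S n. R' u v \<longleftrightarrow> R u v)"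
  have "\<exists>R. \<forall>n. P n (R n) \<and> Q n (R n) (R (Suc n))"
  proof (rule dependent_nat_choice)
    have "inv_on 0 leq" "inv_on (Suc 0) leq" using inv by (simp_all add: inv_on_def)
    then show "\<exists>R. P 0 R" using leq by (auto simp: P_def)
  next
    fix R n assume P: "P n R"
    have "\<exists>R'. total_preorder (factor (even n) <#>\<^bsub>K\<^esub> stage S n) R' \<and>
           (\<forall>u\<in>stage S n. \<forall>v\<in>stage S n. R' u v \<longleftrightarrow> R u v) \<and>
           (\<forall>a\<in>factor (even n). \<forall>u\<in>factor (even n) <#>\<^bsub>K\<^esub> stage S n.
              \<forall>v\<in>factor (even n) <#>\<^bsub>K\<^esub> stage S n.
                R' u v \<longrightarrow> R' (a \<otimes>\<^bsub>K\<^esub> u) (a \<otimes>\<^bsub>K\<^esub> v))"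
      using P core_closed free_off_core
      by (intro K.extend_preorder_to_translates[OF subgroup_factor stage_in_K core_subset(1)])
        (auto simp: P_def inv_on_def)
    then obtain R' where R': "total_preorder (stage S (Suc n)) R'"
      "\<And>u v. u \<in> stage S n \<Longrightarrow> v \<in> stage S n \<Longrightarrow> R' u v \<longleftrightarrow> R u v"
      "\<And>a u v. a \<in> factor (even n) \<Longrightarrow> u \<in> stage S (Suc n) \<Longrightarrow> v \<in> stage S (Suc n) \<Longrightarrow>
         R' u v \<Longrightarrow> R' (a \<otimes>\<^bsub>K\<^esub> u) (a \<otimes>\<^bsub>K\<^esub> v)"
      by auto
    \<comment> \<open>This core lies in the old stage, where \<open>R'\<close> and \<open>R\<close>
      agree, and translation does not leave the core.\<close>
    have "inv_on (Suc n) R'"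
      unfolding inv_on_def
    proof (intro ballI impI)
      fix a u v assume *: "a \<in> factor (even (Suc n))" "u \<in> core S (Suc n)" "v \<in> core S (Suc n)" "R' u v"
      then have "R (a \<otimes>\<^bsub>K\<^esub> u) (a \<otimes>\<^bsub>K\<^esub> v)"
        using P R'(2)[of u v] core_subset(2)[of n] unfolding P_def inv_on_def by blast
      then show "R' (a \<otimes>\<^bsub>K\<^esub> u) (a \<otimes>\<^bsub>K\<^esub> v)"
        using R'(2)[of "a \<otimes>\<^bsub>K\<^esub> u" "a \<otimes>\<^bsub>K\<^esub> v"] core_closed[OF *(1)] *(2,3) core_subset(2)[of n] by blast
    qed
    \<comment> \<open>This core is the entire new stage, on which the extension step has just given
      invariance.\<close>
    moreover have "inv_on (Suc (Suc n)) R'"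
      using R'(3) by (simp add: inv_on_def)
    ultimately show "\<exists>R'. P (Suc n) R' \<and> Q n R R'"
      using R'(1,2) by (auto simp: P_def Q_def)
  qed
  then obtain R where P: "\<And>n. P n (R n)" and Q: "\<And>n. Q n (R n) (R (Suc n))" by blast
  have R_Suc: "R (Suc n) u v \<longleftrightarrow> R n u v" if "u \<in> stage S n" "v \<in> stage S n" for n u v
    using Q[of n] that by (simp add: Q_def)
  have R_mono: "R m u v \<longleftrightarrow> R n u v" if "n \<le> m" "u \<in> stage S n" "v \<in> stage S n" for m n u v
    using that(1)
  proof (induction m rule: dec_induct)
    case (step m)
    then show ?case using R_Suc[of u m v] stage_mono[OF step(1)] that by blast
  qed simp
  \<comment> \<open>The union of the chain: any stage containing both points gives the same
    answer.\<close>
  define leq' where "leq' = (\<lambda>u v. \<exists>n. u \<in> stage S n \<and> v \<in> stage S n \<and> R n u v)"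
  have leq'_eq: "leq' u v \<longleftrightarrow> R n u v" if "u \<in> stage S n" "v \<in> stage S n" for n u v
    using that R_mono[of _ n u v] R_mono[of n _ u v] unfolding leq'_def by (metis nle_le)
  have common: "\<exists>n. u \<in> stage S n \<and> v \<in> stage S n \<and> w \<in> stage S n"
    if uvw: "u \<in> carrier K" "v \<in> carrier K" "w \<in> carrier K" for u v w
  proof -
    obtain i j k where "u \<in> stage S i" "v \<in> stage S j" "w \<in> stage S k"
      using stage_exhausts[OF assms(1)] uvw by metis
    then have "u \<in> stage S (i + j + k)" "v \<in> stage S (i + j + k)" "w \<in> stage S (i + j + k)"
      using stage_mono[of i "i + j + k"] stage_mono[of j "i + j + k"] stage_mono[of k "i + j + k"]
      by auto
    then show ?thesis by blast
  qed
  have "total_preorder (carrier K) leq'"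
    unfolding total_preorder_def
  proof (intro conjI ballI impI)
    fix u v assume "u \<in> carrier K" "v \<in> carrier K"
    then obtain n where n: "u \<in> stage S n" "v \<in> stage S n" using common by blast
    then have "R n u v \<or> R n v u"
      using P[of n] total_preorder_total[of "stage S n" "R n"] unfolding P_def by blast
    then show "leq' u v \<or> leq' v u" using n leq'_eq by blast
  next
    fix u v w assume *: "u \<in> carrier K" "v \<in> carrier K" "w \<in> carrier K" "leq' u v" "leq' v w"
    obtain n where n: "u \<in> stage S n" "v \<in> stage S n" "w \<in> stage S n" using common * by blast
    then have "R n u v" "R n v w" using * leq'_eq by blast+
    then have "R n u w" using P[of n] total_preorder_trans n unfolding P_def by metis
    then show "leq' u w" using n leq'_eq by blast
  qed
  moreover have "left_invariant K leq'"
  proof (rule left_invariant_if_factor_invariant)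
    fix b a u v
    assume *: "a \<in> factor b" "u \<in> carrier K" "v \<in> carrier K" "leq' u v"
    obtain n where "u \<in> stage S n" "v \<in> stage S n" using common * by blast
    \<comment> \<open>The parity is such that stage \<open>Suc m\<close> arises by applying
      \<open>factor b\<close>, which therefore maps that stage into itself.\<close>
    then obtain m where m: "u \<in> stage S m" "v \<in> stage S m" "even m = b"
      using stage_Suc[of n] by (cases "even n = b") (blast, metis even_Suc subsetD)
    have uv: "u \<in> stage S (Suc m)" "v \<in> stage S (Suc m)" using m stage_Suc by blast+
    have "R (Suc m) u v" using leq'_eq[OF uv] * by blast
    moreover have "inv_on (Suc (Suc m)) (R (Suc m))" using P[of "Suc m"] by (simp add: P_def)
    ultimately have "R (Suc m) (a \<otimes>\<^bsub>K\<^esub> u) (a \<otimes>\<^bsub>K\<^esub> v)"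
      using uv *(1) m(3) by (simp add: inv_on_def)
    moreover have "a \<otimes>\<^bsub>K\<^esub> u \<in> stage S (Suc m)" "a \<otimes>\<^bsub>K\<^esub> v \<in> stage S (Suc m)"
      using m *(1) by (auto simp: translates_iff)
    ultimately show "leq' (a \<otimes>\<^bsub>K\<^esub> u) (a \<otimes>\<^bsub>K\<^esub> v)" using leq'_eq by blast
  qed
  moreover have "leq' u v \<longleftrightarrow> leq u v" if "u \<in> star S" "v \<in> star S" for u v
    using leq'_eq[of u 0 v] P[of 0] that by (simp add: P_def)
  ultimately show ?thesis by blast
qed

text \<open>
  The points of the star lying in the same cut of \<open>S\<close> may be interleaved at will: here those
  reached through \<open>factor c\<close> come first.
\<close>

definition interleave :: "bool \<Rightarrow> (('a + 'b) list \<Rightarrow> ('a + 'b) list \<Rightarrow> bool) \<Rightarrow>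
    ('a + 'b) list \<Rightarrow> ('a + 'b) list \<Rightarrow> bool" where
  "interleave c leq = cut_le S leq leq
     (\<lambda>u v. if u \<in> factor c <#>\<^bsub>K\<^esub> S \<longleftrightarrow> v \<in> factor c <#>\<^bsub>K\<^esub> S then leq u v
            else u \<in> factor c <#>\<^bsub>K\<^esub> S)"

lemma total_preorder_interleave:
  assumes "total_preorder (carrier K) leq"
  shows "total_preorder (star S) (interleave c leq)"
  unfolding interleave_def
proof (rule total_preorder_cut_le)
  have leq: "total_preorder (star S) leq"
    using total_preorder_subset[OF assms star_in_K] .
  \<comment> \<open>A lexicographic order: first the side, then \<open>leq\<close>.\<close>
  show "total_preorder (star S)
    (\<lambda>u v. if u \<in> factor c <#>\<^bsub>K\<^esub> S \<longleftrightarrow> v \<in> factor c <#>\<^bsub>K\<^esub> S then leq u v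
           else u \<in> factor c <#>\<^bsub>K\<^esub> S)"
    unfolding total_preorder_def
    using total_preorder_total[OF leq] total_preorder_trans[OF leq] by (auto split: if_splits)
next
  fix u x assume "u \<in> star S" "x \<in> S"
  then show "leq u x \<or> leq x u"
    using total_preorder_total[OF assms] star_in_K S(1) by blast
next
  fix u v x y
  assume *: "u \<in> star S" "v \<in> star S" "x \<in> S" "y \<in> S" "leq u x" "leq x v" "leq v y"
  then have c: "u \<in> carrier K" "v \<in> carrier K" "x \<in> carrier K" "y \<in> carrier K"
    using star_in_K S(1) by blast+
  show "leq u y"
    using total_preorder_trans[OF assms total_preorder_trans[OF assms *(5,6)] *(7)] c by simp
qed

text \<open>The tie-breaker can deviate from \<open>leq\<close> only for points on different sides.
  Two translates under the same factor are on different sides only if one of them belongs to both,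
  hence to \<open>S\<close>, and then the cut decides.\<close>

lemma interleave_agrees:
  assumes "total_preorder (carrier K) leq"
    and "u \<in> factor b <#>\<^bsub>K\<^esub> S" "v \<in> factor b <#>\<^bsub>K\<^esub> S"
  shows "interleave c leq u v \<longleftrightarrow> leq u v"
  unfolding interleave_def
proof (rule cut_le_agrees[OF assms(1) S(1)])
  show "u \<in> carrier K" "v \<in> carrier K" using assms(2,3) translates_in_K[OF S(1)] by blast+
  show "u \<in> S \<or> v \<in> S \<or> (if u \<in> factor c <#>\<^bsub>K\<^esub> S \<longleftrightarrow> v \<in> factor c <#>\<^bsub>K\<^esub> S then leq u v
            else u \<in> factor c <#>\<^bsub>K\<^esub> S) = leq u v"
    using assms(2,3) translates_Int[OF S, of _ b] by (cases "c = b") auto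
qed simp_all

text \<open>On each side \<open>interleave c leq\<close> coincides with the invariant
  \<open>leq\<close>, so it extends to the free product. Points strictly above \<open>S\<close> are
  not separated by \<open>S\<close>; the tie-breaker then puts side \<open>c\<close> first.\<close>

theorem perturb_preorder:
  assumes "[] \<in> S" and leq: "total_preorder (carrier K) leq" "left_invariant K leq"
  shows "\<exists>leq'. total_preorder (carrier K) leq' \<and> left_invariant K leq' \<and>
           (\<forall>b. \<forall>u\<in>factor b <#>\<^bsub>K\<^esub> S. \<forall>v\<in>factor b <#>\<^bsub>K\<^esub> S. leq' u v \<longleftrightarrow> leq u v) \<and>
           (\<forall>u\<in>factor c <#>\<^bsub>K\<^esub> S. \<forall>v\<in>factor (\<not> c) <#>\<^bsub>K\<^esub> S.
              (\<forall>s\<in>S. \<not> leq u s \<and> \<not> leq v s) \<longrightarrow> \<not> leq' v u)"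
proof -
  have "interleave c leq (a \<otimes>\<^bsub>K\<^esub> u) (a \<otimes>\<^bsub>K\<^esub> v)"
    if *: "a \<in> factor b" "u \<in> factor b <#>\<^bsub>K\<^esub> S" "v \<in> factor b <#>\<^bsub>K\<^esub> S" "interleave c leq u v" for a b u v
  proof -
    have "leq (a \<otimes>\<^bsub>K\<^esub> u) (a \<otimes>\<^bsub>K\<^esub> v)"
      using * interleave_agrees[OF leq(1) *(2,3)] factor_in_K translates_in_K[OF S(1), of b]
      by (intro left_invariantD[OF leq(2)]) auto
    then show ?thesis
      using interleave_agrees[OF leq(1), of "a \<otimes>\<^bsub>K\<^esub> u" b "a \<otimes>\<^bsub>K\<^esub> v"] translates_closed[OF S(1) *(1)] * by blast
  qed
  then obtain leq' where leq': "total_preorder (carrier K) leq'" "left_invariant K leq'"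
    "\<And>u v. u \<in> star S \<Longrightarrow> v \<in> star S \<Longrightarrow> leq' u v \<longleftrightarrow> interleave c leq u v"
    using extend_to_free_product[OF assms(1) total_preorder_interleave[OF leq(1)], of c] by blast
  have "leq' u v \<longleftrightarrow> leq u v"
    if "u \<in> factor b <#>\<^bsub>K\<^esub> S" "v \<in> factor b <#>\<^bsub>K\<^esub> S" for b u v
    using leq'(3)[of u v] interleave_agrees[OF leq(1) that] that translates_subset_star by blast
  moreover have "\<not> leq' v u"
    if u: "u \<in> factor c <#>\<^bsub>K\<^esub> S" and v: "v \<in> factor (\<not> c) <#>\<^bsub>K\<^esub> S"
      and above: "\<forall>s\<in>S. \<not> leq u s \<and> \<not> leq v s" for u v
  proof -
    have "v \<notin> factor c <#>\<^bsub>K\<^esub> S"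
      using translates_Int[OF S _ v] above total_preorder_refl[OF leq(1)] S(1) by blast
    then have "\<not> interleave c leq v u"
      using u above by (auto simp: interleave_def cut_le_def)
    then show ?thesis using leq'(3)[of v u] u v translates_subset_star by blast
  qed
  ultimately show ?thesis using leq'(1,2) by blast
qed

end

end
section \<open>Left-preorders relative to a subgroup\<close>

context group
begin

lemma subgroup_of_preorder_kernel:
  assumes leq: "total_preorder (carrier G) leq" "left_invariant G leq"
  shows "subgroup {k \<in> carrier G. leq k \<one> \<and> leq \<one> k} G"
proof
  show "\<one> \<in> {k \<in> carrier G. leq k \<one> \<and> leq \<one> k}"
    using total_preorder_refl[OF leq(1)] by simp
  fix k assume k: "k \<in> {k \<in> carrier G. leq k \<one> \<and> leq \<one> k}"
  then have kc: "k \<in> carrier G" by simp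
  have "leq (inv k \<otimes> k) (inv k \<otimes> \<one>)" "leq (inv k \<otimes> \<one>) (inv k \<otimes> k)"
    using k by (intro left_invariantD[OF leq(2)]; simp)+
  then show "inv k \<in> {k \<in> carrier G. leq k \<one> \<and> leq \<one> k}" using kc by simp
  fix l assume l: "l \<in> {k \<in> carrier G. leq k \<one> \<and> leq \<one> k}"
  have "leq (k \<otimes> l) (k \<otimes> \<one>)" "leq (k \<otimes> \<one>) (k \<otimes> l)"
    using k l by (intro left_invariantD[OF leq(2)]; simp)+
  then have "leq (k \<otimes> l) k" "leq k (k \<otimes> l)" using kc by simp_all
  then show "k \<otimes> l \<in> {k \<in> carrier G. leq k \<one> \<and> leq \<one> k}"
    using k l total_preorder_trans[OF leq(1), of "k \<otimes> l" k \<one>]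
      total_preorder_trans[OF leq(1), of \<one> k "k \<otimes> l"] by simp
qed auto

lemma left_invariant_cancel:
  assumes "left_invariant G leq" "k \<in> carrier G" "u \<in> carrier G" "v \<in> carrier G"
  shows "leq (k \<otimes> u) (k \<otimes> v) \<longleftrightarrow> leq u v"
proof
  have cancel: "inv k \<otimes> (k \<otimes> w) = w" if "w \<in> carrier G" for w
    using assms(2) that by (simp flip: m_assoc)
  assume "leq (k \<otimes> u) (k \<otimes> v)"
  then have "leq (inv k \<otimes> (k \<otimes> u)) (inv k \<otimes> (k \<otimes> v))"
    using left_invariantD[OF assms(1) _ inv_closed[OF assms(2)]] assms(2-4) by simp
  then show "leq u v" using cancel assms(3,4) by simp
next
  assume "leq u v"
  then show "leq (k \<otimes> u) (k \<otimes> v)" using left_invariantD[OF assms(1) _ assms(2-4)] by simp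
qed

lemma left_preorder_relativeD:
  assumes "left_preorder_relative G C R"
  shows "total_preorder (carrier G) (\<lambda>u v. (u, v) \<in> R)"
    and "left_invariant G (\<lambda>u v. (u, v) \<in> R)"
    and "R \<subseteq> carrier G \<times> carrier G" and "R \<noteq> carrier G \<times> carrier G"
    and "C = {k \<in> carrier G. (k, \<one>) \<in> R \<and> (\<one>, k) \<in> R}"
proof -
  have R: "preorder_on (carrier G) R" "total_on (carrier G) R"
    "\<forall>g\<in>carrier G. \<forall>(g1, g2)\<in>R. (g \<otimes> g1, g \<otimes> g2) \<in> R"
    "R \<noteq> carrier G \<times> carrier G" "preorder_kernel G R = C"
    using assms unfolding left_preorder_relative_def left_preorder_def by auto
  show "R \<subseteq> carrier G \<times> carrier G" "R \<noteq> carrier G \<times> carrier G"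
    using R(1,4) by (auto simp: preorder_on_def)
  show "C = {k \<in> carrier G. (k, \<one>) \<in> R \<and> (\<one>, k) \<in> R}"
    using R(5) by (auto simp: preorder_kernel_def)
  show "left_invariant G (\<lambda>u v. (u, v) \<in> R)"
    using R(3) by (auto simp: left_invariant_def)
  show "total_preorder (carrier G) (\<lambda>u v. (u, v) \<in> R)"
    unfolding total_preorder_def
  proof (intro conjI ballI impI)
    fix x y assume "x \<in> carrier G" "y \<in> carrier G"
    then show "(x, y) \<in> R \<or> (y, x) \<in> R"
      using R(1,2) by (cases "x = y") (auto simp: preorder_on_def refl_on_def total_on_def)
  next
    fix x y z assume "(x, y) \<in> R" "(y, z) \<in> R"
    then show "(x, z) \<in> R" using R(1) by (meson preorder_on_def transD)
  qed
qed

text \<open>The preorder \<open>leq\<close> may identify more than \<open>C\<close> does. Breaking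
  its ties by \<open>R\<close> leaves exactly what is tied in both, so the kernel shrinks to
  \<open>C\<close>.\<close>

lemma left_preorder_relative_lexicographic:
  assumes leq: "total_preorder (carrier G) leq" "left_invariant G leq"
    and R: "left_preorder_relative G C R"
    and C: "\<And>k. k \<in> C \<Longrightarrow> leq k \<one> \<and> leq \<one> k"
  defines "L \<equiv> {(u, v). u \<in> carrier G \<and> v \<in> carrier G \<and> leq u v \<and> (leq v u \<longrightarrow> (u, v) \<in> R)}"
  shows "left_preorder_relative G C L"
proof -
  note R = left_preorder_relativeD[OF R]
  have trans: "(x, z) \<in> L" if "(x, y) \<in> L" "(y, z) \<in> L" for x y z
  proof -
    have c: "x \<in> carrier G" "y \<in> carrier G" "z \<in> carrier G" and l: "leq x y" "leq y z"
      and r: "leq y x \<longrightarrow> (x, y) \<in> R" "leq z y \<longrightarrow> (y, z) \<in> R"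
      using that by (auto simp: L_def)
    have "leq x z" using total_preorder_trans[OF leq(1) l] c by simp
    moreover have "(x, z) \<in> R" if "leq z x"
    proof -
      have "leq y x" "leq z y"
        using total_preorder_trans[OF leq(1) l(2) that] total_preorder_trans[OF leq(1) that l(1)] c
        by simp_all
      then show ?thesis using r total_preorder_trans[OF R(1), of x y z] c by simp
    qed
    ultimately show ?thesis using c by (simp add: L_def)
  qed
  have "preorder_on (carrier G) L"
    unfolding preorder_on_def
  proof (intro conjI)
    show "refl_on (carrier G) L"
      using total_preorder_refl[OF leq(1)] total_preorder_refl[OF R(1)]
      by (simp add: refl_on_def L_def)
    show "trans L" using trans by (rule transI)
  qed (auto simp: L_def)
  moreover have "total_on (carrier G) L"
    unfolding total_on_def
  proof (intro ballI impI)
    fix u v assume "u \<in> carrier G" "v \<in> carrier G"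
    then show "(u, v) \<in> L \<or> (v, u) \<in> L"
      using total_preorder_total[OF leq(1), of u v] total_preorder_total[OF R(1), of u v]
      by (auto simp: L_def)
  qed
  moreover have "(g \<otimes> u, g \<otimes> v) \<in> L" if "g \<in> carrier G" "(u, v) \<in> L" for g u v
    using that left_invariant_cancel[OF leq(2), of g] left_invariant_cancel[OF R(2), of g]
    by (auto simp: L_def)
  moreover have "L \<noteq> carrier G \<times> carrier G"
  proof
    \<comment> \<open>Every pair would be a tie of \<open>leq\<close>, hence a pair of
      \<open>R\<close>, which is non-trivial.\<close>
    assume "L = carrier G \<times> carrier G"
    then have "(u, v) \<in> R" if "u \<in> carrier G" "v \<in> carrier G" for u v
      using that by (auto simp: L_def set_eq_iff)
    then show False using R(3,4) by auto
  qed
  moreover have "preorder_kernel G L = C"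
    using C R(5) by (auto simp: preorder_kernel_def L_def)
  ultimately show ?thesis
    by (auto simp: left_preorder_relative_def left_preorder_def)
qed

section \<open>Sign maps and isolated points\<close>

lemma preorder_map_apply:
  assumes R: "left_preorder_relative G C R" and g: "g \<in> carrier G"
  shows "preorder_map G R g = (if (\<one>, g) \<in> R then if (g, \<one>) \<in> R then 0 else 1 else -1)"
proof -
  note R = left_preorder_relativeD[OF R]
  have pos: "h \<in> positive_cone G R \<longleftrightarrow> h \<in> carrier G \<and> (\<one>, h) \<in> R \<and> (h, \<one>) \<notin> R" for h
    by (auto simp: positive_cone_def preorder_kernel_def)
  have "g \<in> set_inv\<^bsub>G\<^esub> (positive_cone G R) \<longleftrightarrow> inv g \<in> positive_cone G R"
    using g by (auto simp: SET_INV_def pos intro!: bexI[of _ "inv g"])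
  also have "\<dots> \<longleftrightarrow> (g, \<one>) \<in> R \<and> (\<one>, g) \<notin> R"
    using left_invariant_cancel[OF R(2) g, of \<one> "inv g"] 
      left_invariant_cancel[OF R(2) g, of "inv g" \<one>] g by (simp add: pos)
  finally show ?thesis
    using g pos total_preorder_total[OF R(1), of \<one> g] by (auto simp: preorder_map_def)
qed

text \<open>By left-invariance \<open>(u, v)\<close> is decided by
  \<open>(\<one>, inv u \<otimes> v)\<close>, hence by the sign at a single element.\<close>

lemma preorder_map_inject:
  assumes R: "left_preorder_relative G C R" and R': "left_preorder_relative G C R'"
    and eq: "preorder_map G R = preorder_map G R'"
  shows "R = R'"
proof -
  have "(u, v) \<in> R \<longleftrightarrow> (u, v) \<in> R'" if uv: "u \<in> carrier G" "v \<in> carrier G" for u v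
  proof -
    let ?g = "inv u \<otimes> v"
    have "(u, v) \<in> Q \<longleftrightarrow> preorder_map G Q ?g \<noteq> -1" if "left_preorder_relative G C Q" for Q
    proof -
      have "(u, v) = (u \<otimes> \<one>, u \<otimes> ?g)" using uv by (simp flip: m_assoc)
      then have "(u, v) \<in> Q \<longleftrightarrow> (\<one>, ?g) \<in> Q"
        using left_invariant_cancel[OF left_preorder_relativeD(2)[OF that], of u \<one> ?g] uv by simp
      then show ?thesis using preorder_map_apply[OF that, of ?g] uv by simp
    qed
    then show ?thesis using R R' eq by simp
  qed
  then show ?thesis
    using left_preorder_relativeD(3)[OF R] left_preorder_relativeD(3)[OF R'] by auto
qed

text \<open>An open set around the sign map contains a basic box, which restricts finitely many
  coordinates; these form \<open>E\<close>. Injectivity of the sign map leads back from maps to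
  relations.\<close>

lemma isolated_preorder_finitely_determined:
  assumes "isolated_point (PO_topology G C) \<phi>"
  obtains R E where "left_preorder_relative G C R" "finite E" "E \<subseteq> carrier G"
    "\<forall>R'. left_preorder_relative G C R' \<longrightarrow>
       (\<forall>g\<in>E. preorder_map G R' g = preorder_map G R g) \<longrightarrow> R' = R"
proof -
  let ?T = "product_topology (\<lambda>_. discrete_topology {-1, 0, 1 :: int}) (carrier G)"
  have mem: "preorder_map G R \<in> topspace ?T" if "left_preorder_relative G C R" for R
    using preorder_map_apply[OF that] by (auto simp: preorder_map_def PiE_iff extensional_def)
  obtain T where T: "openin ?T T" "{\<phi>} = T \<inter> PO_set G C"
    using assms by (auto simp: isolated_point_def PO_topology_def openin_subtopology)
  then obtain R where R: "left_preorder_relative G C R" "\<phi> = preorder_map G R"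
    unfolding PO_set_def by blast
  have "\<phi> \<in> T" using T(2) by blast
  then obtain U where U: "finite {g \<in> carrier G. U g \<noteq> {-1, 0, 1}}"
    "\<phi> \<in> PiE (carrier G) U" "PiE (carrier G) U \<subseteq> T"
    using T(1) by (simp add: openin_product_topology_alt) blast
  show ?thesis
  proof (rule that[OF R(1) U(1)]; (intro allI impI)?)
    fix R' assume R': "left_preorder_relative G C R'"
      and agree: "\<forall>g\<in>{g \<in> carrier G. U g \<noteq> {-1, 0, 1}}. preorder_map G R' g = preorder_map G R g"
    have "preorder_map G R' \<in> PiE (carrier G) U"
    proof (rule PiE_I)
      fix g assume g: "g \<in> carrier G"
      show "preorder_map G R' g \<in> U g"
      proof (cases "U g = {-1, 0, 1}")
        case True
        then show ?thesis using preorder_map_apply[OF R' g] by simp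
      next
        case False
        then show ?thesis using agree g U(2) R(2) by auto
      qed
    qed (simp add: preorder_map_def)
    then have "preorder_map G R' \<in> T \<inter> PO_set G C"
      using U(3) R' by (auto simp: PO_set_def)
    then have "preorder_map G R' = preorder_map G R" using T(2) R(2) by blast
    then show "R' = R" using preorder_map_inject[OF R' R(1)] by simp
  qed auto
qed

end

lemma finite_total_preorder_max:
  assumes "finite S" "S \<noteq> {}" "total_preorder S leq"
  obtains m where "m \<in> S" "\<And>s. s \<in> S \<Longrightarrow> leq s m"
proof -
  have "\<exists>m\<in>S. \<forall>s\<in>S. leq s m"
    using assms
  proof (induction S rule: finite_ne_induct)
    case (singleton x)
    then show ?case using total_preorder_refl by fastforce
  next
    case (insert x S)
    then obtain m where m: "m \<in> S" "\<forall>s\<in>S. leq s m"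
      using total_preorder_subset[OF insert.prems] by blast
    have xm: "leq x m \<or> leq m x" using total_preorder_total[OF insert.prems] m(1) by simp
    show ?case
    proof (cases "leq x m")
      case True
      then show ?thesis using m by blast
    next
      case False
      then have "leq s x" if "s \<in> S" for s
        using xm total_preorder_trans[OF insert.prems, of s m x] m that by simp
      then show ?thesis using total_preorder_refl[OF insert.prems] by auto
    qed
  qed
  then show ?thesis using that by blast
qed

section \<open>Generators from the Kurosh decomposition\<close>

context free_product_of_groups
begin

lemma finite_suffix_closure:
  assumes "finite E" "E \<subseteq> carrier K"
  obtains S where "finite S" "E \<subseteq> S" "[] \<in> S" "S \<subseteq> carrier K" "suffix_closed S"
proof
  let ?S = "insert [] {v. \<exists>w\<in>E. \<exists>n. v = drop n w}"
  have "v \<in> (\<Union>w\<in>E. (\<lambda>n. drop n w) ` {..length w})" if "w \<in> E" "v = drop n w" for v w n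
  proof -
    \<comment> \<open>Dropping more than the length gives the empty word, so a word has finitely
      many suffixes.\<close>
    have "v = drop (min n (length w)) w" using that(2) by (auto simp: min_def)
    then have "v \<in> (\<lambda>n. drop n w) ` {..length w}" by (rule image_eqI) simp
    then show ?thesis using that(1) by blast
  qed
  then have "{v. \<exists>w\<in>E. \<exists>n. v = drop n w} \<subseteq> (\<Union>w\<in>E. (\<lambda>n. drop n w) ` {..length w})"
    by blast
  then show "finite ?S" using assms(1) by (simp add: finite_subset)
  have "\<exists>v\<in>E. \<exists>n. w = drop n v" if "w \<in> E" for w
    using that by (intro bexI[of _ w] exI[of _ 0]) auto
  then show "E \<subseteq> ?S" by blast
  show "[] \<in> ?S" by simp
  have "drop n w \<in> carrier K" if "w \<in> carrier K" for n w
    using that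
  proof (induction n arbitrary: w)
    case (Suc n)
    then show ?case using Cons_in_K(2) by (cases w) auto
  qed simp
  then show "?S \<subseteq> carrier K" using assms(2) K.one_closed by auto
  show "suffix_closed ?S"
    unfolding suffix_closed_def
  proof (intro allI impI)
    fix x w assume "x # w \<in> ?S"
    then obtain v n where v: "v \<in> E" "x # w = drop n v" by auto
    have "w = drop (Suc n) v"
      using arg_cong[OF v(2), of tl] by (simp add: drop_Suc tl_drop)
    then show "w \<in> ?S" using v(1) by blast
  qed
qed

lemma conj_inter_factor:
  "conj_inter K C (factor b) x =
     {c \<in> C. \<exists>g\<in>factor b. c = x \<otimes>\<^bsub>K\<^esub> g \<otimes>\<^bsub>K\<^esub> inv\<^bsub>K\<^esub> x}"
  by (auto simp: conj_inter_def l_coset_def r_coset_def)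

lemma double_coset_representative:
  assumes reps: "double_coset_reps K C (factor b) X" and C: "subgroup C K" and z: "z \<in> carrier K"
  obtains x c g where "x \<in> X" "c \<in> C" "g \<in> factor b" "z = c \<otimes>\<^bsub>K\<^esub> (x \<otimes>\<^bsub>K\<^esub> g)"
proof -
  let ?coset = "\<lambda>x. C <#>\<^bsub>K\<^esub> (x <#\<^bsub>K\<^esub> factor b)"
  have "?coset ` X = ?coset ` carrier K"
    using reps unfolding double_coset_reps_def by (metis bij_betw_imp_surj_on)
  then have "?coset z \<in> ?coset ` X" using z by simp
  then obtain x where x: "x \<in> X" "?coset z = ?coset x" by blast
  have mem: "y \<in> ?coset u \<longleftrightarrow> (\<exists>c\<in>C. \<exists>g\<in>factor b. y = c \<otimes>\<^bsub>K\<^esub> (u \<otimes>\<^bsub>K\<^esub> g))" for y u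
    by (auto simp: set_mult_def l_coset_def)
  have "\<one>\<^bsub>K\<^esub> \<otimes>\<^bsub>K\<^esub> (z \<otimes>\<^bsub>K\<^esub> \<one>\<^bsub>K\<^esub>) \<in> ?coset z"
    unfolding mem using subgroup.one_closed[OF C] subgroup.one_closed[OF subgroup_factor, of b] by blast
  then have "z \<in> ?coset x"
    unfolding x(2) using K.l_one[OF z] K.r_one[OF z] by argo
  then show ?thesis using that x(1) mem by blast
qed

lemma free_basis_generates:
  assumes "free_basis K F B" "subgroup D K" "B \<subseteq> D"
  shows "F \<subseteq> D"
proof
  fix f assume "f \<in> F"
  then obtain w where w: "w \<in> freely_reduced B"
    "f = foldr (\<otimes>\<^bsub>K\<^esub>) (map (\<lambda>(b, s). if s then b else inv\<^bsub>K\<^esub> b) w) \<one>\<^bsub>K\<^esub>"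
    using assms(1) unfolding free_basis_def bij_betw_def by blast
  have "fst ` set w \<subseteq> B" using w(1) by (simp add: freely_reduced_def)
  then have "foldr (\<otimes>\<^bsub>K\<^esub>) (map (\<lambda>(b, s). if s then b else inv\<^bsub>K\<^esub> b) w) \<one>\<^bsub>K\<^esub> \<in> D"
  proof (induction w)
    case Nil
    then show ?case using subgroup.one_closed[OF assms(2)] by simp
  next
    case (Cons p w)
    then show ?case
      using assms(3) subgroup.m_closed[OF assms(2)] subgroup.m_inv_closed[OF assms(2)]
      by (cases p) auto
  qed
  then show "f \<in> D" using w(2) by simp
qed

text \<open>Every element of \<open>C\<close> is spelled by letters from the factors, so an
  inclusion of \<open>C\<close> can be tested factor by factor.\<close>

lemma kurosh_factors_generate:
  assumes dec: "kurosh_decomposition G H C F X Y" and D: "subgroup D K"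
    and F: "F \<subseteq> D" and X: "\<And>x. x \<in> X \<Longrightarrow> conj_inter K C (factor True) x \<subseteq> D"
    and Y: "\<And>y. y \<in> Y \<Longrightarrow> conj_inter K C (factor False) y \<subseteq> D"
  shows "C \<subseteq> D"
proof
  let ?I = "insert Free_Part (Left_Part ` X \<union> Right_Part ` Y)"
  fix c assume "c \<in> C"
  then obtain w where w: "w \<in> family_reduced K ?I (kurosh_factor G H C F)"
    "c = foldr (\<otimes>\<^bsub>K\<^esub>) (map snd w) \<one>\<^bsub>K\<^esub>"
    using dec unfolding kurosh_decomposition_def internal_free_product_def bij_betw_def by blast
  have factors: "kurosh_factor G H C F i \<subseteq> D" if "i \<in> ?I" for i
    using that F X[THEN subsetD] Y[THEN subsetD] by (auto simp: factor_def)
  have "set (map snd w) \<subseteq> D"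
  proof
    fix g assume "g \<in> set (map snd w)"
    then obtain i where "(i, g) \<in> set w" by auto
    then have "(i, g) \<in> Sigma ?I (\<lambda>i. kurosh_factor G H C F i - {\<one>\<^bsub>K\<^esub>})"
      using w(1) unfolding family_reduced_def by blast
    then show "g \<in> D" using factors by blast
  qed
  then have "foldr (\<otimes>\<^bsub>K\<^esub>) (map snd w) \<one>\<^bsub>K\<^esub> \<in> D"
    using subgroup.one_closed[OF D] subgroup.m_closed[OF D] by (induction w) auto
  then show "c \<in> D" using w(2) by simp
qed

text \<open>
  If a factor fixes the coset of \<open>m\<close>, then \<open>C\<close> contains a whole conjugate of that factor, so the
  coset of \<open>m\<close> is that of the inverse of one of the representatives contributing to the Kurosh rank.
\<close>

lemma factor_moves:
  assumes leq: "total_preorder (carrier K) leq" "left_invariant K leq"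
    and C: "C = {k \<in> carrier K. leq k [] \<and> leq [] k}"
    and reps: "double_coset_reps K C (factor b) X" and nontriv: "factor b \<noteq> {[]}"
    and m: "m \<in> carrier K"
    and above: "\<And>x. x \<in> X \<Longrightarrow> conj_inter K C (factor b) x \<noteq> {[]} \<Longrightarrow> \<not> leq m (inv\<^bsub>K\<^esub> x)"
  shows "\<exists>a\<in>factor b. \<not> leq (a \<otimes>\<^bsub>K\<^esub> m) m"
proof (rule ccontr)
  assume "\<not> ?thesis"
  then have le: "leq (a \<otimes>\<^bsub>K\<^esub> m) m" if "a \<in> factor b" for a using that by blast
  have subC: "subgroup C K"
    using K.subgroup_of_preorder_kernel[OF leq] C by simp
  note Cc = subgroup.mem_carrier[OF subC]
  \<comment> \<open>The bound for \<open>inv a\<close>, translated by \<open>a\<close>, shows that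
    \<open>m\<close> is also below \<open>a m\<close>. So \<open>a\<close> fixes the coset of
    \<open>m\<close>.\<close>
  have mem: "inv\<^bsub>K\<^esub> m \<otimes>\<^bsub>K\<^esub> (a \<otimes>\<^bsub>K\<^esub> m) \<in> C" if a: "a \<in> factor b" for a
  proof -
    have ac: "a \<in> carrier K" "inv\<^bsub>K\<^esub> a \<in> factor b"
      using a factor_in_K subgroup.m_inv_closed[OF subgroup_factor] by blast+
    have "leq (a \<otimes>\<^bsub>K\<^esub> (inv\<^bsub>K\<^esub> a \<otimes>\<^bsub>K\<^esub> m)) (a \<otimes>\<^bsub>K\<^esub> m)"
      using left_invariantD[OF leq(2) le[OF ac(2)] ac(1)] ac m by simp
    moreover have "a \<otimes>\<^bsub>K\<^esub> (inv\<^bsub>K\<^esub> a \<otimes>\<^bsub>K\<^esub> m) = m"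
      using ac m K.r_inv K.l_one by (simp flip: K.m_assoc)
    ultimately have ge: "leq m (a \<otimes>\<^bsub>K\<^esub> m)" by simp
    have im: "inv\<^bsub>K\<^esub> m \<in> carrier K" "inv\<^bsub>K\<^esub> m \<otimes>\<^bsub>K\<^esub> m = []" using m K.l_inv by simp_all
    show ?thesis
      using left_invariantD[OF leq(2) le[OF a] im(1)] left_invariantD[OF leq(2) ge im(1)] ac m im C
      by simp
  qed
  \<comment> \<open>The inverse appears because the preorder orders cosets \<open>k C\<close>,
    whereas the representatives are those of double cosets with \<open>C\<close> on the
    left.\<close>
  obtain x c g where x: "x \<in> X" "c \<in> C" "g \<in> factor b" "inv\<^bsub>K\<^esub> m = c \<otimes>\<^bsub>K\<^esub> (x \<otimes>\<^bsub>K\<^esub> g)"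
    using double_coset_representative[OF reps subC] m by (metis K.inv_closed)
  have xc: "x \<in> carrier K" "c \<in> carrier K" "g \<in> carrier K"
    using reps x Cc factor_in_K by (auto simp: double_coset_reps_def)
  have m_eq: "m = inv\<^bsub>K\<^esub> g \<otimes>\<^bsub>K\<^esub> (inv\<^bsub>K\<^esub> x \<otimes>\<^bsub>K\<^esub> inv\<^bsub>K\<^esub> c)"
    using x(4) xc m by (metis K.inv_inv K.inv_mult_group K.m_assoc K.inv_closed K.m_closed)
  \<comment> \<open>\<open>?a\<close> is chosen so that the \<open>g\<close> in \<open>m_eq\<close>
    cancels; conjugation by \<open>c\<close> then leaves the conjugate of \<open>h\<close> by
    \<open>x\<close>.\<close>
  have conj: "x \<otimes>\<^bsub>K\<^esub> h \<otimes>\<^bsub>K\<^esub> inv\<^bsub>K\<^esub> x \<in> C" if h: "h \<in> factor b" for h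
  proof -
    let ?a = "inv\<^bsub>K\<^esub> g \<otimes>\<^bsub>K\<^esub> (h \<otimes>\<^bsub>K\<^esub> g)"
    have hc: "h \<in> carrier K" using h factor_in_K by blast
    have "?a \<in> factor b"
      using h x(3) subgroup.m_inv_closed[OF subgroup_factor] subgroup.m_closed[OF subgroup_factor]
      by blast
    then have "inv\<^bsub>K\<^esub> m \<otimes>\<^bsub>K\<^esub> (?a \<otimes>\<^bsub>K\<^esub> m) \<in> C" using mem by blast
    then have "inv\<^bsub>K\<^esub> c \<otimes>\<^bsub>K\<^esub> (inv\<^bsub>K\<^esub> m \<otimes>\<^bsub>K\<^esub> (?a \<otimes>\<^bsub>K\<^esub> m)) \<otimes>\<^bsub>K\<^esub> c \<in> C"
      using x(2) subgroup.m_inv_closed[OF subC] subgroup.m_closed[OF subC] by blast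
    moreover have "inv\<^bsub>K\<^esub> c \<otimes>\<^bsub>K\<^esub> (inv\<^bsub>K\<^esub> m \<otimes>\<^bsub>K\<^esub> (?a \<otimes>\<^bsub>K\<^esub> m)) \<otimes>\<^bsub>K\<^esub> c =
        x \<otimes>\<^bsub>K\<^esub> h \<otimes>\<^bsub>K\<^esub> inv\<^bsub>K\<^esub> x"
    proof -
      have cancel: "inv\<^bsub>K\<^esub> u \<otimes>\<^bsub>K\<^esub> (u \<otimes>\<^bsub>K\<^esub> v) = v" "u \<otimes>\<^bsub>K\<^esub> (inv\<^bsub>K\<^esub> u \<otimes>\<^bsub>K\<^esub> v) = v"
        if "u \<in> carrier K" "v \<in> carrier K" for u v
        using that K.l_inv K.r_inv K.l_one by (simp_all flip: K.m_assoc)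
      have "?a \<otimes>\<^bsub>K\<^esub> m = inv\<^bsub>K\<^esub> g \<otimes>\<^bsub>K\<^esub> (h \<otimes>\<^bsub>K\<^esub> (inv\<^bsub>K\<^esub> x \<otimes>\<^bsub>K\<^esub> inv\<^bsub>K\<^esub> c))"
        using xc hc cancel by (simp add: m_eq K.m_assoc)
      then have "inv\<^bsub>K\<^esub> m \<otimes>\<^bsub>K\<^esub> (?a \<otimes>\<^bsub>K\<^esub> m) =
          c \<otimes>\<^bsub>K\<^esub> (x \<otimes>\<^bsub>K\<^esub> (h \<otimes>\<^bsub>K\<^esub> (inv\<^bsub>K\<^esub> x \<otimes>\<^bsub>K\<^esub> inv\<^bsub>K\<^esub> c)))"
        using xc hc cancel by (simp add: x(4) K.m_assoc)
      then show ?thesis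
        using xc hc cancel K.l_inv K.r_one by (simp add: K.m_assoc)
    qed
    ultimately show ?thesis by simp
  qed
  obtain h where h: "h \<in> factor b" "h \<noteq> []" using nontriv Nil_in_factor by blast
  have "x \<otimes>\<^bsub>K\<^esub> h \<otimes>\<^bsub>K\<^esub> inv\<^bsub>K\<^esub> x \<noteq> []"
  proof
    assume "x \<otimes>\<^bsub>K\<^esub> h \<otimes>\<^bsub>K\<^esub> inv\<^bsub>K\<^esub> x = []"
    then have "x \<otimes>\<^bsub>K\<^esub> h = x"
      using xc factor_in_K[OF h(1)] K.inv_equality[of "x \<otimes>\<^bsub>K\<^esub> h" "inv\<^bsub>K\<^esub> x"] K.inv_inv[OF xc(1)] by simp
    then show False using h(2) K.l_cancel_one[OF xc(1) factor_in_K[OF h(1)]] by simp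
  qed
  then have "conj_inter K C (factor b) x \<noteq> {[]}"
    using conj[OF h(1)] h(1) by (auto simp: conj_inter_factor)
  then have "\<not> leq m (inv\<^bsub>K\<^esub> x)" using above x(1) by blast
  \<comment> \<open>\<open>m\<close> is equivalent to \<open>m c\<close>, which equals
    \<open>inv g\<close> times \<open>inv x\<close>, and \<open>inv g\<close> fixes the coset of
    \<open>inv x\<close> by \<open>conj\<close>.\<close>
  moreover have "leq m (inv\<^bsub>K\<^esub> x)"
  proof -
    have "leq [] c" using x(2) C by blast
    then have "leq m (m \<otimes>\<^bsub>K\<^esub> c)"
      using left_invariantD[OF leq(2), of "[]" c m] m xc K.r_one[OF m] K.one_closed by simp
    moreover have gm: "m \<otimes>\<^bsub>K\<^esub> c = inv\<^bsub>K\<^esub> g \<otimes>\<^bsub>K\<^esub> inv\<^bsub>K\<^esub> x"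
      using xc K.l_inv K.r_one by (simp add: m_eq K.m_assoc)
    moreover have "leq (inv\<^bsub>K\<^esub> g \<otimes>\<^bsub>K\<^esub> inv\<^bsub>K\<^esub> x) (inv\<^bsub>K\<^esub> x)"
    proof -
      have "inv\<^bsub>K\<^esub> g \<in> factor b" using x(3) subgroup.m_inv_closed[OF subgroup_factor] by blast
      then have "x \<otimes>\<^bsub>K\<^esub> inv\<^bsub>K\<^esub> g \<otimes>\<^bsub>K\<^esub> inv\<^bsub>K\<^esub> x \<in> C" using conj by blast
      then have "leq (x \<otimes>\<^bsub>K\<^esub> (inv\<^bsub>K\<^esub> g \<otimes>\<^bsub>K\<^esub> inv\<^bsub>K\<^esub> x)) (x \<otimes>\<^bsub>K\<^esub> inv\<^bsub>K\<^esub> x)"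
        using C xc K.r_inv by (simp add: K.m_assoc)
      then show ?thesis 
        using K.left_invariant_cancel[OF leq(2) xc(1), of "inv\<^bsub>K\<^esub> g \<otimes>\<^bsub>K\<^esub> inv\<^bsub>K\<^esub> x" "inv\<^bsub>K\<^esub> x"]
          xc by simp
    qed
    ultimately show ?thesis
      using total_preorder_trans[OF leq(1), of m "m \<otimes>\<^bsub>K\<^esub> c" "inv\<^bsub>K\<^esub> x"] m xc by simp
  qed
  ultimately show False by blast
qed

text \<open>That \<open>x g inv x\<close> lies in a kernel means that \<open>g inv x\<close> and
  \<open>inv x\<close> are equivalent. Both are translates of \<open>inv x\<close> under one factor,
  so agreement on translates of \<open>S\<close> preserves this for all \<open>g\<close> at once,
  even in an infinite factor. Elements of \<open>B\<close> are compared with the identity inside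
  \<open>S\<close>.\<close>

lemma preorder_contains_kurosh_generators:
  assumes leq: "total_preorder (carrier K) leq" "left_invariant K leq"
    and C: "C = {k \<in> carrier K. leq k [] \<and> leq [] k}"
    and S: "[] \<in> S" "S \<subseteq> carrier K"
    and dec: "kurosh_decomposition G H C F X Y" and basis: "free_basis K F B" "B \<subseteq> S"
    and X: "\<And>x. x \<in> X \<Longrightarrow> conj_inter K C (factor True) x \<noteq> {[]} \<Longrightarrow> inv\<^bsub>K\<^esub> x \<in> S"
    and Y: "\<And>y. y \<in> Y \<Longrightarrow> conj_inter K C (factor False) y \<noteq> {[]} \<Longrightarrow> inv\<^bsub>K\<^esub> y \<in> S"
    and leq': "total_preorder (carrier K) leq'" "left_invariant K leq'"
    and agree: "\<And>b u v. u \<in> factor b <#>\<^bsub>K\<^esub> S \<Longrightarrow> v \<in> factor b <#>\<^bsub>K\<^esub> S \<Longrightarrow>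
                  leq' u v \<longleftrightarrow> leq u v"
    and k: "k \<in> C"
  shows "leq' k [] \<and> leq' [] k"
proof -
  let ?D = "{k \<in> carrier K. leq' k [] \<and> leq' [] k}"
  have D: "subgroup ?D K" using K.subgroup_of_preorder_kernel[OF leq'] by simp
  have S_star: "S \<subseteq> factor b <#>\<^bsub>K\<^esub> S" for b using subset_translates[OF S(2)] .
  have conj: "conj_inter K C (factor b) x \<subseteq> ?D"
    if x: "x \<in> carrier K" and xS: "conj_inter K C (factor b) x \<noteq> {[]} \<Longrightarrow> inv\<^bsub>K\<^esub> x \<in> S" for b x
  proof (cases "conj_inter K C (factor b) x = {[]}")
    case True
    then show ?thesis using subgroup.one_closed[OF D] by simp
  next
    case False
    have ix: "inv\<^bsub>K\<^esub> x \<in> S" "inv\<^bsub>K\<^esub> x \<in> carrier K" using xS[OF False] S(2) by auto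
    show ?thesis
    proof
      fix c assume "c \<in> conj_inter K C (factor b) x"
      then obtain g where g: "c \<in> C" "g \<in> factor b" "c = x \<otimes>\<^bsub>K\<^esub> g \<otimes>\<^bsub>K\<^esub> inv\<^bsub>K\<^esub> x"
        by (auto simp: conj_inter_factor)
      let ?u = "g \<otimes>\<^bsub>K\<^esub> inv\<^bsub>K\<^esub> x"
      have gc: "g \<in> carrier K" "?u \<in> carrier K" using factor_in_K[OF g(2)] ix by auto
      have u: "?u \<in> factor b <#>\<^bsub>K\<^esub> S" using g(2) ix(1) by (auto simp: translates_iff)
      have c: "c = x \<otimes>\<^bsub>K\<^esub> ?u" "[] = x \<otimes>\<^bsub>K\<^esub> inv\<^bsub>K\<^esub> x"
        using g(3) x gc ix K.r_inv[OF x] by (simp_all add: K.m_assoc)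
      have "leq c []" "leq [] c" using g(1) C by blast+
      then have "leq ?u (inv\<^bsub>K\<^esub> x)" "leq (inv\<^bsub>K\<^esub> x) ?u"
        using K.left_invariant_cancel[OF leq(2) x gc(2) ix(2)]
          K.left_invariant_cancel[OF leq(2) x ix(2) gc(2)] c by simp_all
      then have "leq' ?u (inv\<^bsub>K\<^esub> x)" "leq' (inv\<^bsub>K\<^esub> x) ?u"
        using agree[of ?u b] agree[of "inv\<^bsub>K\<^esub> x" b ?u] u ix(1) S_star by blast+
      then have "leq' c []" "leq' [] c"
        using K.left_invariant_cancel[OF leq'(2) x gc(2) ix(2)]
          K.left_invariant_cancel[OF leq'(2) x ix(2) gc(2)] c by simp_all
      then show "c \<in> ?D" using c(1) x gc(2) by simp
    qed
  qed
  have "B \<subseteq> ?D"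
  proof
    fix k assume kB: "k \<in> B"
    have "F \<subseteq> C"
    proof
      fix f assume f: "f \<in> F"
      let ?I = "insert Free_Part (Left_Part ` X \<union> Right_Part ` Y)"
      have fam: "bij_betw (\<lambda>w. foldr (\<otimes>\<^bsub>K\<^esub>) (map snd w) \<one>\<^bsub>K\<^esub>)
          (family_reduced K ?I (kurosh_factor G H C F)) C"
        using dec by (simp add: kurosh_decomposition_def internal_free_product_def)
      have fc: "f \<in> carrier K"
        using f basis(1) subgroup.mem_carrier unfolding free_basis_def by metis
      show "f \<in> C"
      proof (cases "f = []")
        case True
        then show ?thesis using C total_preorder_refl[OF leq(1) fc] fc by simp
      next
        case False
        \<comment> \<open>A non-trivial element of \<open>F\<close> is a reduced word of length one,
          so its value lies in \<open>C\<close>.\<close>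
        then have "[(Free_Part, f)] \<in> family_reduced K ?I (kurosh_factor G H C F)"
          using f by (simp add: family_reduced_def)
        then have "foldr (\<otimes>\<^bsub>K\<^esub>) (map snd [(Free_Part :: ('a + 'b) list kurosh_index, f)]) \<one>\<^bsub>K\<^esub> \<in> C"
          using bij_betw_apply[OF fam] by blast
        then show ?thesis using K.r_one[OF fc] by simp
      qed
    qed
    then have "k \<in> C" "k \<in> S" using kB basis unfolding free_basis_def by blast+
    then show "k \<in> ?D"
      using C agree[of k True "[]"] agree[of "[]" True k] S_star[of True] S(1) by blast
  qed
  then have "F \<subseteq> ?D" using free_basis_generates[OF basis(1) D] by blast
  moreover have "X \<subseteq> carrier K" "Y \<subseteq> carrier K"
    using dec by (auto simp: kurosh_decomposition_def double_coset_reps_def)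
  ultimately have "C \<subseteq> ?D"
    using kurosh_factors_generate[OF dec D] conj X Y by (meson subsetD)
  then show ?thesis using k by blast
qed

text \<open>Some factor element moves the maximum of \<open>S\<close> strictly upwards; otherwise
  the whole group would keep it below itself and the kernel would be everything. The moved point has
  its tail in \<open>S\<close>, so adding it preserves suffix closure.\<close>

lemma finite_set_dominated:
  assumes leq: "total_preorder (carrier K) leq" "left_invariant K leq"
    and proper: "{k \<in> carrier K. leq k [] \<and> leq [] k} \<noteq> carrier K"
    and S: "finite S" "[] \<in> S" "S \<subseteq> carrier K" "suffix_closed S"
  obtains m where "m \<in> carrier K" "suffix_closed (insert m S)"
    "\<And>s. s \<in> S \<Longrightarrow> leq s m" "\<And>s. s \<in> S \<Longrightarrow> \<not> leq m s"
proof -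
  obtain m where m: "m \<in> S" "\<And>s. s \<in> S \<Longrightarrow> leq s m"
    using finite_total_preorder_max[OF S(1) _ total_preorder_subset[OF leq(1) S(3)]] S(2) by blast
  have mc: "m \<in> carrier K" using m(1) S(3) by blast
  have "\<exists>b. \<exists>a\<in>factor b. \<not> leq (a \<otimes>\<^bsub>K\<^esub> m) m"
  proof (rule ccontr)
    assume "\<not> ?thesis"
    then have le: "leq (a \<otimes>\<^bsub>K\<^esub> m) m" if "a \<in> factor b" for a b using that by blast
    have le_K: "leq (k \<otimes>\<^bsub>K\<^esub> m) m" if "k \<in> carrier K" for k
      using that
    proof (induction k rule: K_induct)
      case one
      then show ?case using le[OF Nil_in_factor] by simp
    next
      case (factor b a w)
      have ac: "a \<in> carrier K" using factor_in_K[OF factor(1)] .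
      have "leq (a \<otimes>\<^bsub>K\<^esub> (w \<otimes>\<^bsub>K\<^esub> m)) (a \<otimes>\<^bsub>K\<^esub> m)"
        using left_invariantD[OF leq(2) factor(3) ac] factor(2) mc by simp
      then show ?case
        using total_preorder_trans[OF leq(1) _ le[OF factor(1)]] factor(2) ac mc
        by (simp add: K.m_assoc)
    qed
    have im: "inv\<^bsub>K\<^esub> m \<in> carrier K" "inv\<^bsub>K\<^esub> m \<otimes>\<^bsub>K\<^esub> m = []" "m \<otimes>\<^bsub>K\<^esub> inv\<^bsub>K\<^esub> m = []"
      using mc K.l_inv K.r_inv by simp_all
    have "leq k []" if k: "k \<in> carrier K" for k
    proof -
      \<comment> \<open>\<open>le_K\<close> for the conjugate of \<open>k\<close> by
        \<open>m\<close> puts \<open>m k\<close> below \<open>m\<close>; cancelling \<open>m\<close>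
        puts \<open>k\<close> below the identity.\<close>
      have eq: "(m \<otimes>\<^bsub>K\<^esub> k \<otimes>\<^bsub>K\<^esub> inv\<^bsub>K\<^esub> m) \<otimes>\<^bsub>K\<^esub> m = m \<otimes>\<^bsub>K\<^esub> k"
        using mc im k K.r_one[OF k] by (simp add: K.m_assoc)
      have "leq (m \<otimes>\<^bsub>K\<^esub> k) (m \<otimes>\<^bsub>K\<^esub> \<one>\<^bsub>K\<^esub>)"
        using le_K[of "m \<otimes>\<^bsub>K\<^esub> k \<otimes>\<^bsub>K\<^esub> inv\<^bsub>K\<^esub> m"] eq mc im k K.r_one[OF mc] by simp
      then show ?thesis
        using K.left_invariant_cancel[OF leq(2) mc k K.one_closed] by simp
    qed
    note below = this
    have "leq [] k" if k: "k \<in> carrier K" for k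
    proof -
      have "leq (k \<otimes>\<^bsub>K\<^esub> inv\<^bsub>K\<^esub> k) (k \<otimes>\<^bsub>K\<^esub> \<one>\<^bsub>K\<^esub>)"
        using K.left_invariant_cancel[OF leq(2) k, of "inv\<^bsub>K\<^esub> k" "\<one>\<^bsub>K\<^esub>"] below k K.one_closed by simp
      then show ?thesis using K.r_inv[OF k] K.r_one[OF k] by simp
    qed
    then show False using below proper by blast
  qed
  then obtain b a where a: "a \<in> factor b" "\<not> leq (a \<otimes>\<^bsub>K\<^esub> m) m" by blast
  let ?m = "a \<otimes>\<^bsub>K\<^esub> m"
  have c: "?m \<in> carrier K" using factor_in_K[OF a(1)] mc by simp
  have m_le: "leq m ?m" using total_preorder_total[OF leq(1) c mc] a(2) by blast
  show ?thesis
  proof (rule that[OF c])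
    have "?m \<in> factor b <#>\<^bsub>K\<^esub> S" using a(1) m(1) by (auto simp: translates_iff)
    then show "suffix_closed (insert ?m S)"
      using translates_tail[OF S(3,4)] S(4) unfolding suffix_closed_def by (metis insert_iff)
    fix s assume s: "s \<in> S"
    then have sc: "s \<in> carrier K" using S(3) by blast
    show "leq s ?m" using total_preorder_trans[OF leq(1) m(2)[OF s] m_le] sc mc c by simp
    show "\<not> leq ?m s" using total_preorder_trans[OF leq(1) _ m(2)[OF s]] a(2) sc mc c by blast
  qed
qed

section \<open>Two incompatible perturbations\<close>

lemma factor_nontrivial:
  assumes "carrier G \<noteq> {\<one>\<^bsub>G\<^esub>}" "carrier H \<noteq> {\<one>\<^bsub>H\<^esub>}"
  shows "factor b \<noteq> {[]}"
proof -
  have "carrier G - {\<one>\<^bsub>G\<^esub>} \<noteq> {}" "carrier H - {\<one>\<^bsub>H\<^esub>} \<noteq> {}"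
    using assms G.one_closed H.one_closed by blast+
  then show ?thesis by (auto simp: factor_def left_factor_def right_factor_def)
qed

text \<open>An isolated preorder is determined by its signs on a finite set \<open>E\<close>.
  Perturbing it with either factor first preserves these signs and hence changes nothing, yet the
  two perturbations order \<open>p True\<close> and \<open>p False\<close> oppositely.\<close>

theorem no_isolated_preorder:
  assumes nontriv: "carrier G \<noteq> {\<one>\<^bsub>G\<^esub>}" "carrier H \<noteq> {\<one>\<^bsub>H\<^esub>}"
    and proper: "C \<noteq> carrier K" and rank: "finite_kurosh_rank G H C"
  shows "\<not> isolated_point (PO_topology K C) \<phi>"
proof
  assume "isolated_point (PO_topology K C) \<phi>"
  then obtain R E where R: "left_preorder_relative K C R" and E: "finite E" "E \<subseteq> carrier K"
    and unique: "\<forall>R'. left_preorder_relative K C R' \<longrightarrow>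
       (\<forall>g\<in>E. preorder_map K R' g = preorder_map K R g) \<longrightarrow> R' = R"
    by (rule K.isolated_preorder_finitely_determined) (rule that)
  define leq where "leq = (\<lambda>u v. (u, v) \<in> R)"
  have leq: "total_preorder (carrier K) leq" "left_invariant K leq"
    and C: "C = {k \<in> carrier K. leq k [] \<and> leq [] k}"
    using K.left_preorder_relativeD[OF R] by (simp_all add: leq_def)
  obtain F B X Y where dec: "kurosh_decomposition G H C F X Y" and basis: "free_basis K F B"
    and fin: "finite B" "finite {x \<in> X. conj_inter K C (factor True) x \<noteq> {[]}}"
      "finite {y \<in> Y. conj_inter K C (factor False) y \<noteq> {[]}}"
    using rank by (auto simp: finite_kurosh_rank_def has_kurosh_rank_def Let_def factor_def)
  define reps where "reps = (\<lambda>b. if b then X else Y)"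
  have reps: "double_coset_reps K C (factor b) (reps b)" for b
    using dec by (simp add: kurosh_decomposition_def reps_def factor_def)
  then have reps_in_K: "reps b \<subseteq> carrier K" for b by (auto simp: double_coset_reps_def)
  define N where "N = (\<lambda>b. {x \<in> reps b. conj_inter K C (factor b) x \<noteq> {[]}})"
  \<comment> \<open>\<open>E\<close> secures the signs; \<open>B\<close> and the inverted
    representatives keep \<open>C\<close> inside the kernel of a perturbation. The representatives
    also serve to show that both factors move \<open>m\<close>.\<close>
  let ?E = "E \<union> B \<union> (m_inv K ` N True \<union> m_inv K ` N False)"
  have "B \<subseteq> carrier K"
    using basis subgroup.subset unfolding free_basis_def by blast
  moreover have "N b \<subseteq> carrier K" for b using reps_in_K by (auto simp: N_def)
  then have "m_inv K ` N b \<subseteq> carrier K" for b by blast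
  moreover have "finite (N b)" for b using fin by (cases b) (simp_all add: N_def reps_def)
  ultimately have "finite ?E" "?E \<subseteq> carrier K" using E fin(1) by simp_all
  then obtain S where S: "finite S" "[] \<in> S" "S \<subseteq> carrier K" "suffix_closed S" and ES: "?E \<subseteq> S"
    by (rule finite_suffix_closure) (rule that)
  obtain m where m: "m \<in> carrier K" "suffix_closed (insert m S)"
    "\<And>s. s \<in> S \<Longrightarrow> leq s m" "\<And>s. s \<in> S \<Longrightarrow> \<not> leq m s"
    using finite_set_dominated[OF leq _ S] proper C by blast
  let ?S = "insert m S"
  have S': "[] \<in> ?S" "?S \<subseteq> carrier K" using S m(1) by auto
  have inv_S: "inv\<^bsub>K\<^esub> x \<in> S" if "x \<in> reps b" "conj_inter K C (factor b) x \<noteq> {[]}" for x b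
  proof -
    have "inv\<^bsub>K\<^esub> x \<in> m_inv K ` N b" using that by (simp add: N_def)
    then show ?thesis using ES by (cases b) auto
  qed
  \<comment> \<open>\<open>m\<close> is strictly above every inverted representative with
    non-trivial intersection, so neither factor can fix its coset.\<close>
  have "\<exists>a\<in>factor b. \<not> leq (a \<otimes>\<^bsub>K\<^esub> m) m" for b
    using inv_S m(4) by (intro factor_moves[OF leq C reps factor_nontrivial[OF nontriv] m(1)]) blast
  then obtain a where a: "\<And>b. a b \<in> factor b" "\<And>b. \<not> leq (a b \<otimes>\<^bsub>K\<^esub> m) m" by metis
  define p where "p = (\<lambda>b. a b \<otimes>\<^bsub>K\<^esub> m)"
  have p: "p b \<in> factor b <#>\<^bsub>K\<^esub> ?S" "p b \<in> carrier K" for b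
    using a(1) m(1) factor_in_K[OF a(1)] by (auto simp: p_def translates_iff)
  have above: "\<not> leq (p b) s" if "s \<in> ?S" for b s
  proof -
    have "s \<in> carrier K" "leq s m" using that m S(3) total_preorder_refl[OF leq(1)] by auto
    then show ?thesis
      using total_preorder_trans[OF leq(1), of "p b" s m] a(2)[of b] p(2)[of b] m(1)
      unfolding p_def by blast
  qed
  have "\<not> leq (p (\<not> c)) (p c)" for c
  proof -
    obtain leq' where leq': "total_preorder (carrier K) leq'" "left_invariant K leq'"
      and agree: "\<And>b u v. u \<in> factor b <#>\<^bsub>K\<^esub> ?S \<Longrightarrow> v \<in> factor b <#>\<^bsub>K\<^esub> ?S \<Longrightarrow>
        leq' u v \<longleftrightarrow> leq u v"
      and flip: "\<And>u v. u \<in> factor c <#>\<^bsub>K\<^esub> ?S \<Longrightarrow> v \<in> factor (\<not> c) <#>\<^bsub>K\<^esub> ?S \<Longrightarrow>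
        (\<forall>s\<in>?S. \<not> leq u s \<and> \<not> leq v s) \<Longrightarrow> \<not> leq' v u"
      using perturb_preorder[OF S'(2) m(2) S'(1) leq, of c] by blast
    define L where "L = {(u, v). u \<in> carrier K \<and> v \<in> carrier K \<and> leq' u v \<and> (leq' v u \<longrightarrow> (u, v) \<in> R)}"
    have "leq' k [] \<and> leq' [] k" if "k \<in> C" for k
    proof (rule preorder_contains_kurosh_generators[OF leq C S' dec basis _ _ _ leq' agree that])
      show "B \<subseteq> ?S" using ES by blast
      show "inv\<^bsub>K\<^esub> x \<in> ?S" if "x \<in> X" "conj_inter K C (factor True) x \<noteq> {[]}" for x
        using inv_S[of x True] that by (simp add: reps_def)
      show "inv\<^bsub>K\<^esub> x \<in> ?S" if "x \<in> Y" "conj_inter K C (factor False) x \<noteq> {[]}" for x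
        using inv_S[of x False] that by (simp add: reps_def)
    qed
    then have L: "left_preorder_relative K C L"
      unfolding L_def by (intro K.left_preorder_relative_lexicographic[OF leq' R]) simp
    have "L = R"
    proof (rule unique[rule_format, OF L])
      fix g assume g: "g \<in> E"
      then have gc: "g \<in> carrier K" "g \<in> factor True <#>\<^bsub>K\<^esub> ?S" "[] \<in> factor True <#>\<^bsub>K\<^esub> ?S"
        using E ES S'(1) subset_translates[OF S'(2), of True] by blast+
      \<comment> \<open>Both \<open>g\<close> and the identity lie in \<open>S\<close>, where
        \<open>leq'\<close> agrees with \<open>leq\<close>, so breaking ties by \<open>R\<close>
        reproduces \<open>R\<close>.\<close>
      have "(g, []) \<in> L \<longleftrightarrow> (g, []) \<in> R" "([], g) \<in> L \<longleftrightarrow> ([], g) \<in> R"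
        using agree[OF gc(2,3)] agree[OF gc(3,2)] gc(1) S(2,3) by (auto simp: L_def leq_def)
      then show "preorder_map K L g = preorder_map K R g"
        using K.preorder_map_apply[OF L gc(1)] K.preorder_map_apply[OF R gc(1)] by simp
    qed
    moreover have "\<not> leq' (p (\<not> c)) (p c)"
      using flip[OF p(1)[of c] p(1)[of "\<not> c"]] above by blast
    ultimately show ?thesis by (auto simp: L_def leq_def)
  qed
  \<comment> \<open>Opposite strict inequalities between the same two points contradict
    totality.\<close>
  from this[of True] this[of False] show False
    using total_preorder_total[OF leq(1) p(2)[of True] p(2)[of False]] by simp
qed

end

theorem theorem4p4:
  fixes G :: "('a, 'm) monoid_scheme"
    and H :: "('b, 'n) monoid_scheme"
    and C :: "('a + 'b) list set"
  assumes "group G" and "group H"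
    and "carrier G \<noteq> {\<one>\<^bsub>G\<^esub>}" and "carrier H \<noteq> {\<one>\<^bsub>H\<^esub>}"
    and "left_relatively_convex (free_product G H) C"
    and "finite_kurosh_rank G H C"
  shows "\<nexists>\<phi>. isolated_point (PO_topology (free_product G H) C) \<phi>"
proof -
  interpret free_product_of_groups G H
    using assms(1,2) by (rule free_product_of_groups.intro)
  show ?thesis
    using no_isolated_preorder[OF assms(3,4) _ assms(6)] assms(5)
    by (auto simp: left_relatively_convex_def)
qed

end
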